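(* The pseudocentre of the Thompson group $F$ is its commutator subgroup $F'$.
   Context: For a group $G$, the pseudocentre is $P(G)=\bigcap_{x\in G}C_G(x)^G$, where $C_G(x)$ is the centralizer of $x$ in $G$ and, for a subgroup $H\leq G$, $H^G$ is the normal closure of $H$ in $G$. The Thompson group $F$ is the group, under composition, of all orientation-preserving piecewise linear homeomorphisms of $[0,1]$ with finitely many points of non-differentiability, all lying in $\mathbb Z[1/2]$, and all of whose slopes are of the form $2^n$ with $n\in\mathbb Z$. *)

theory Defs
  imports "HOL-Analysis.Analysis" "HOL-Algebra.Bij" "HOL-Algebra.Generated_Groups"
begin

section \<open>The pseudocentre of a group\<close>

definition centralizer :: "('a, 'b) monoid_scheme \<Rightarrow> 'a \<Rightarrow> 'a set" where
  "centralizer G x = {g \<in> carrier G. g \<otimes>\<^bsub>G\<^esub> x = x \<otimes>\<^bsub>G\<^esub> g}"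

definition normal_closure :: "('a, 'b) monoid_scheme \<Rightarrow> 'a set \<Rightarrow> 'a set" where
  "normal_closure G H = \<Inter>{N. N \<lhd> G \<and> H \<subseteq> N}"

definition pseudocentre :: "('a, 'b) monoid_scheme \<Rightarrow> 'a set" where
  "pseudocentre G = (\<Inter>x\<in>carrier G. normal_closure G (centralizer G x))"


section \<open>The Thompson group F\<close>

text \<open>The subring Z[1/2] of the reals.\<close>

definition dyadic_rationals :: "real set" where
  "dyadic_rationals = {of_int a / 2 ^ k | (a :: int) (k :: nat). True}"

definition piecewise_linear_on :: "real \<Rightarrow> real \<Rightarrow> (real \<Rightarrow> real) \<Rightarrow> bool" where
  "piecewise_linear_on a b f \<longleftrightarrow>
     (\<exists>(n :: nat) t. t 0 = a \<and> t n = b \<and>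
       (\<forall>i<n. t i < t (Suc i) \<and> (\<exists>m c. \<forall>x\<in>{t i..t (Suc i)}. f x = m * x + c)))"

text \<open>
  Elements of \<open>F\<close> are represented, as in \<^const>\<open>BijGroup\<close>, by functions on the reals that are
  \<^const>\<open>undefined\<close> outside of the unit interval. Differentiability and slopes are therefore taken
  within the interval, i.e. one-sidedly at the two end points. A homeomorphism of an interval
  preserves the orientation iff it is increasing.
\<close>

definition thompson_F_carrier :: "(real \<Rightarrow> real) set" where
  "thompson_F_carrier = {f \<in> extensional {0..1}.
     (\<exists>g. homeomorphism {0..1} {0..1} f g) \<and>
     strict_mono_on {0..1} f \<and>
     piecewise_linear_on 0 1 f \<and>
     finite {x \<in> {0..1}. \<not> f differentiable (at x within {0..1})} \<and>
     {x \<in> {0..1}. \<not> f differentiable (at x within {0..1})} \<subseteq> dyadic_rationals \<and>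
     (\<forall>x\<in>{0..1}. \<forall>m. (f has_real_derivative m) (at x within {0..1}) \<longrightarrow>
        (\<exists>n :: int. m = 2 powi n))}"

definition thompson_F :: "(real \<Rightarrow> real) monoid" where
  "thompson_F = (BijGroup {0..1})\<lparr>carrier := thompson_F_carrier\<rparr>"

end

theory Submission
  imports Defs
begin

text \<open>
  Extending the elements of \<open>F\<close> by the identity turns composition into plain composition of functions on
  the line. An element \<open>y\<close> of \<open>F\<close> without fixed points in the open interval has the property that everything
  commuting with it is determined by its germ at \<open>0\<close>, so the pairs of logarithmic slopes at \<open>0\<close> and \<open>1\<close> of
  the elements of \<open>C(y)\<close> lie on the line through that of \<open>y\<close>. Two choices of \<open>y\<close> with different lines, namely
  \<open>(1, -1)\<close> and \<open>(1, -2)\<close>, show that elements of the pseudocentre have slope \<open>1\<close> at both end points, as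
  elements of \<open>F'\<close> do. Conversely no centralizer is trivial, and every nontrivial normal subgroup \<open>N\<close> contains
  all elements with slope \<open>1\<close> at both end points. By Higman's double commutator trick, \<open>N\<close> contains the
  commutators of elements supported in \<open>[1/2, 3/4]\<close>. Tree pairs show that \<open>F\<close> is generated by the rescaled
  copies of \<open>x\<^sub>0\<close>, one for each standard dyadic interval, and the pentagon relation makes one of these copies a
  conjugate of a commutator. As the copies on interior intervals are all conjugate in \<open>F\<close>, all elements supported
  in \<open>[1/2, 3/4]\<close> lie in \<open>N\<close>, and every compactly supported element is conjugate to one of these.
\<close>

section \<open>Locally dyadic affine maps of the line\<close>

text \<open>The obstacle is that the copy of F on \<open>[1/2, 3/4]\<close> is not perfect:
  commutators of its elements have slope 1 at the ends of that interval, so Higman's trick alone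
  cannot reach the whole copy. The pentagon relation provides a copy of \<open>x0\<close> on a
  smaller interval inside that is conjugate to such a commutator, and an element of the ambient
  group stretches this smaller interval onto \<open>[1/2, 3/4]\<close>. That is why membership in
  \<open>N\<close> is proved by induction over generators and not for F itself. Neither the
  abelianization of F nor the simplicity of F' is presupposed. The commutator subgroup enters as one
  more nontrivial normal subgroup \<open>N\<close>, which yields the inclusion that is hard to see
  directly. The elements \<open>y\<close> have slope exactly 2 at 0, so that the slope at 0 of any
  element commuting with \<open>y\<close> is an integral power of that of \<open>y\<close>; the
  centralizer is then generated by \<open>y\<close>. A line of pairs of logarithmic slopes cuts out
  the kernel of a homomorphism to the integers, hence a normal subgroup, and so it bounds the normal
  closure of the centralizer too.\<close>

text \<open>The notation for inverse functions is taken by inverses in groups.\<close>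

abbreviation finv :: "('a \<Rightarrow> 'b) \<Rightarrow> 'b \<Rightarrow> 'a" where
  "finv f \<equiv> inv_into UNIV f"

lemma dyadic_of_int [simp, intro]: "of_int j / 2 ^ n \<in> dyadic_rationals"
  by (auto simp: dyadic_rationals_def)

lemma dyadic_zero [simp, intro]: "0 \<in> dyadic_rationals"
  using dyadic_of_int[of 0 0] by simp

lemma dyadic_one [simp, intro]: "1 \<in> dyadic_rationals"
  using dyadic_of_int[of 1 0] by simp

lemma dyadic_add [intro]:
  assumes "x \<in> dyadic_rationals" "y \<in> dyadic_rationals"
  shows "x + y \<in> dyadic_rationals"
proof -
  obtain a k b l where xy: "x = of_int a / 2 ^ k" "y = of_int b / 2 ^ l"
    using assms by (auto simp: dyadic_rationals_def)
  have "x + y = of_int (a * 2 ^ l + b * 2 ^ k) / 2 ^ (k + l)"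
    unfolding xy by (simp add: field_simps power_add)
  then show ?thesis using dyadic_of_int by metis
qed

lemma dyadic_mult [intro]:
  assumes "x \<in> dyadic_rationals" "y \<in> dyadic_rationals"
  shows "x * y \<in> dyadic_rationals"
proof -
  obtain a k b l where xy: "x = of_int a / 2 ^ k" "y = of_int b / 2 ^ l"
    using assms by (auto simp: dyadic_rationals_def)
  have "x * y = of_int (a * b) / 2 ^ (k + l)"
    unfolding xy by (simp add: field_simps power_add)
  then show ?thesis using dyadic_of_int by metis
qed

lemma dyadic_uminus [intro]:
  assumes "x \<in> dyadic_rationals"
  shows "- x \<in> dyadic_rationals"
proof -
  obtain a k where "x = of_int a / 2 ^ k"
    using assms by (auto simp: dyadic_rationals_def)
  then have "- x = of_int (- a) / 2 ^ k"
    by simp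
  then show ?thesis using dyadic_of_int by metis
qed

lemma dyadic_diff [intro]:
  assumes "x \<in> dyadic_rationals" "y \<in> dyadic_rationals"
  shows "x - y \<in> dyadic_rationals"
  using dyadic_add[OF assms(1) dyadic_uminus[OF assms(2)]] by simp

lemma dyadic_powi [simp, intro]: "2 powi k \<in> dyadic_rationals"
proof (cases "k \<ge> 0")
  case True
  then show ?thesis using dyadic_of_int[of "2 ^ nat k" 0] by (simp add: power_int_def)
next
  case False
  then show ?thesis using dyadic_of_int[of 1 "nat (- k)"] by (simp add: power_int_def field_simps)
qed

text \<open>The translation part is required to be dyadic although the definition of F speaks only
  of slopes and break points. This makes the maps preserve dyadic rationals in both directions; for
  elements of F it is recovered in \<open>thompson_F_carrier_extend\<close>.\<close>

definition dyadic_affine :: "(real \<Rightarrow> real) \<Rightarrow> bool" where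
  "dyadic_affine h \<longleftrightarrow> (\<exists>(k :: int) d. d \<in> dyadic_rationals \<and> h = (\<lambda>x. 2 powi k * x + d))"

lemma dyadic_affineI: "d \<in> dyadic_rationals \<Longrightarrow> dyadic_affine (\<lambda>x. 2 powi k * x + d)"
  by (auto simp: dyadic_affine_def)

lemma dyadic_affine_id: "dyadic_affine (\<lambda>x. x)"
  using dyadic_affineI[of 0 0] by simp

lemma dyadic_affine_comp:
  assumes "dyadic_affine g" "dyadic_affine h"
  shows "dyadic_affine (g \<circ> h)"
proof -
  obtain k d k' d' where d: "d \<in> dyadic_rationals" "d' \<in> dyadic_rationals"
    and g: "g = (\<lambda>x. 2 powi k * x + d)" and h: "h = (\<lambda>x. 2 powi k' * x + d')"
    using assms by (auto simp: dyadic_affine_def)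
  have "g \<circ> h = (\<lambda>x. 2 powi (k + k') * x + (2 powi k * d' + d))"
    by (auto simp: g h fun_eq_iff power_int_add algebra_simps)
  moreover have "2 powi k * d' + d \<in> dyadic_rationals"
    using d by auto
  ultimately show ?thesis using dyadic_affineI by metis
qed

lemma dyadic_affine_inverse:
  assumes "dyadic_affine h"
  obtains h' where "dyadic_affine h'" "\<And>x. h' (h x) = x" "\<And>x. h (h' x) = x"
proof -
  obtain k d where d: "d \<in> dyadic_rationals" and h: "h = (\<lambda>x. 2 powi k * x + d)"
    using assms by (auto simp: dyadic_affine_def)
  let ?h' = "\<lambda>x. 2 powi (- k) * x + - (2 powi (- k) * d)"
  have "dyadic_affine ?h'"
    using d by (intro dyadic_affineI) auto
  then show thesis
    by (rule that) (auto simp: h power_int_minus field_simps)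
qed

lemma dyadic_affine_strict_mono: "dyadic_affine h \<Longrightarrow> strict_mono h"
  by (auto simp: dyadic_affine_def strict_mono_def)

lemma dyadic_affine_isCont: "dyadic_affine h \<Longrightarrow> isCont h x"
  by (auto simp: dyadic_affine_def)

lemma dyadic_affine_dyadic:
  assumes "dyadic_affine h"
  shows "h x \<in> dyadic_rationals \<longleftrightarrow> x \<in> dyadic_rationals"
proof -
  have *: "h x \<in> dyadic_rationals" if "x \<in> dyadic_rationals" "dyadic_affine h" for h x
    using that by (auto simp: dyadic_affine_def)
  obtain h' where "dyadic_affine h'" "\<And>x. h' (h x) = x"
    using dyadic_affine_inverse[OF assms] by metis
  then show ?thesis using * assms by metis
qed

definition dyadic_affine_on :: "real set \<Rightarrow> (real \<Rightarrow> real) \<Rightarrow> bool" where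
  "dyadic_affine_on A f \<longleftrightarrow> (\<exists>h. dyadic_affine h \<and> (\<forall>y\<in>A. f y = h y))"

lemma dyadic_affine_on_subset: "dyadic_affine_on B f \<Longrightarrow> A \<subseteq> B \<Longrightarrow> dyadic_affine_on A f"
  by (auto simp: dyadic_affine_on_def)

lemma dyadic_affine_on_cong: "(\<And>x. x \<in> A \<Longrightarrow> f x = g x) \<Longrightarrow> dyadic_affine_on A f \<longleftrightarrow> dyadic_affine_on A g"
  by (auto simp: dyadic_affine_on_def)

lemma dyadic_affine_imp_on: "dyadic_affine h \<Longrightarrow> dyadic_affine_on A h"
  by (auto simp: dyadic_affine_on_def)

lemma dyadic_affine_on_comp:
  assumes "dyadic_affine_on A f" "dyadic_affine_on B g" "f ` A \<subseteq> B"
  shows "dyadic_affine_on A (g \<circ> f)"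
proof -
  obtain h h' where "dyadic_affine h" "\<forall>y\<in>A. f y = h y" "dyadic_affine h'" "\<forall>y\<in>B. g y = h' y"
    using assms by (auto simp: dyadic_affine_on_def)
  moreover from this assms(3) have "\<forall>y\<in>A. (g \<circ> f) y = (h' \<circ> h) y"
    by auto
  ultimately show ?thesis
    using dyadic_affine_comp[of h' h] unfolding dyadic_affine_on_def by (intro exI[of _ "h' \<circ> h"]) auto
qed

lemma dyadic_affine_on_inv:
  assumes "dyadic_affine_on A f" "inj f"
  shows "dyadic_affine_on (f ` A) (finv f)"
proof -
  obtain h where h: "dyadic_affine h" "\<forall>y\<in>A. f y = h y"
    using assms by (auto simp: dyadic_affine_on_def)
  obtain h' where h': "dyadic_affine h'" "\<And>x. h' (h x) = x"
    using dyadic_affine_inverse[OF h(1)] by metis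
  have "finv f (f y) = h' (f y)" if "y \<in> A" for y
    using h h' that inv_into_f_f[OF assms(2) UNIV_I, of y] by simp
  then have "\<forall>y\<in>f ` A. finv f y = h' y"
    by blast
  then show ?thesis using h' unfolding dyadic_affine_on_def by blast
qed

lemma dyadic_affine_on_isCont_within:
  assumes "dyadic_affine_on {a..b} f" "x \<in> {a..b}"
  shows "continuous (at x within {a..b}) f"
proof -
  obtain h where h: "dyadic_affine h" "\<forall>y\<in>{a..b}. f y = h y"
    using assms by (auto simp: dyadic_affine_on_def)
  have "continuous (at x within {a..b}) h"
    using dyadic_affine_isCont[OF h(1)] continuous_at_imp_continuous_within by blast
  then show ?thesis
    by (rule continuous_transform_within[of _ _ _ 1]) (use h assms in auto)
qed

text \<open>Affine germs on each side of every point replace a list of break points: this form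
  passes to composites and inverses point by point, and finiteness on a compact interval comes back
  by bisection. The last clause confines break points to the dyadic rationals.\<close>

definition locally_dyadic :: "(real \<Rightarrow> real) \<Rightarrow> bool" where
  "locally_dyadic f \<longleftrightarrow> (\<forall>x. (\<exists>e>0. dyadic_affine_on {x..x + e} f) \<and>
     (\<exists>e>0. dyadic_affine_on {x - e..x} f) \<and>
     (x \<notin> dyadic_rationals \<longrightarrow> (\<exists>e>0. dyadic_affine_on {x - e..x + e} f)))"

lemma locally_dyadic_uniform_radius:
  assumes "locally_dyadic f"
  obtains e where "e > 0" "dyadic_affine_on {x..x + e} f" "dyadic_affine_on {x - e..x} f"
    "x \<notin> dyadic_rationals \<Longrightarrow> dyadic_affine_on {x - e..x + e} f"
proof -
  obtain e1 e2 where e: "e1 > 0" "e2 > 0" "dyadic_affine_on {x..x + e1} f" "dyadic_affine_on {x - e2..x} f"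
    using assms unfolding locally_dyadic_def by metis
  obtain e3 where e3: "e3 > 0" "x \<notin> dyadic_rationals \<Longrightarrow> dyadic_affine_on {x - e3..x + e3} f"
    using assms unfolding locally_dyadic_def by (metis zero_less_one)
  define e where "e = min e1 (min e2 e3)"
  have "e > 0" "{x..x + e} \<subseteq> {x..x + e1}" "{x - e..x} \<subseteq> {x - e2..x}" "{x - e..x + e} \<subseteq> {x - e3..x + e3}"
    using e e3 by (auto simp: e_def)
  then show thesis
    using that e e3 dyadic_affine_on_subset by metis
qed

lemma locally_dyadic_isCont:
  assumes "locally_dyadic f"
  shows "isCont f x"
proof -
  obtain e where e: "e > 0" "dyadic_affine_on {x..x + e} f" "dyadic_affine_on {x - e..x} f"
    using locally_dyadic_uniform_radius[OF assms] by metis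
  have "continuous (at x within {x..x + e}) f" "continuous (at x within {x - e..x}) f"
    using e by (auto intro: dyadic_affine_on_isCont_within)
  then show ?thesis
    using e by (simp add: continuous_at_split at_within_Icc_at_right at_within_Icc_at_left)
qed

lemma locally_dyadic_dyadic:
  assumes "locally_dyadic f"
  shows "f x \<in> dyadic_rationals \<longleftrightarrow> x \<in> dyadic_rationals"
proof -
  obtain e where e: "e > 0" "dyadic_affine_on {x..x + e} f"
    using locally_dyadic_uniform_radius[OF assms] by metis
  then obtain h where "dyadic_affine h" "f x = h x"
    by (auto simp: dyadic_affine_on_def)
  then show ?thesis using dyadic_affine_dyadic by simp
qed

lemma dyadic_affine_locally_dyadic: "dyadic_affine h \<Longrightarrow> locally_dyadic h"
  unfolding locally_dyadic_def by (auto intro!: exI[of _ 1] dyadic_affine_imp_on)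

text \<open>Monotonicity sends right neighbourhoods of \<open>x\<close> into right neighbourhoods of
  \<open>f x\<close>, and likewise on the left, so one-sided germs compose. Two-sided germs compose
  because \<open>f\<close> keeps non-dyadic points non-dyadic.\<close>

lemma locally_dyadic_comp:
  assumes f: "locally_dyadic f" "mono f" and g: "locally_dyadic g"
  shows "locally_dyadic (g \<circ> f)"
  unfolding locally_dyadic_def
proof
  fix x
  obtain e1 where e1: "e1 > 0" "dyadic_affine_on {x..x + e1} f" "dyadic_affine_on {x - e1..x} f"
    "x \<notin> dyadic_rationals \<Longrightarrow> dyadic_affine_on {x - e1..x + e1} f"
    using locally_dyadic_uniform_radius[OF f(1)] by metis
  obtain e2 where e2: "e2 > 0" "dyadic_affine_on {f x..f x + e2} g" "dyadic_affine_on {f x - e2..f x} g"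
    "f x \<notin> dyadic_rationals \<Longrightarrow> dyadic_affine_on {f x - e2..f x + e2} g"
    using locally_dyadic_uniform_radius[OF g] by metis
  obtain d where d: "d > 0" "\<And>y. \<bar>y - x\<bar> < d \<Longrightarrow> \<bar>f y - f x\<bar> < e2"
    using locally_dyadic_isCont[OF f(1), of x] e2(1)
    by (auto simp: continuous_at_eps_delta dist_real_def)
  define e where "e = min e1 (d / 2)"
  have e: "e > 0" "e \<le> e1" "e < d"
    using e1 d by (auto simp: e_def)
  have near: "f x - e2 \<le> f y" "f y \<le> f x + e2" if "x - e \<le> y" "y \<le> x + e" for y
    using d(2)[of y] e that by (auto simp: abs_less_iff)
  have 1: "f ` {x..x + e} \<subseteq> {f x..f x + e2}" "f ` {x - e..x} \<subseteq> {f x - e2..f x}"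
    "f ` {x - e..x + e} \<subseteq> {f x - e2..f x + e2}"
    using near e monoD[OF f(2)] by (auto simp: image_subset_iff)
  have 2: "{x..x + e} \<subseteq> {x..x + e1}" "{x - e..x} \<subseteq> {x - e1..x}" "{x - e..x + e} \<subseteq> {x - e1..x + e1}"
    using e by auto
  have comp: "dyadic_affine_on A (g \<circ> f)"
    if "A \<subseteq> A'" "dyadic_affine_on A' f" "f ` A \<subseteq> B" "dyadic_affine_on B g" for A A' B
    using that dyadic_affine_on_comp dyadic_affine_on_subset by blast
  show "(\<exists>e>0. dyadic_affine_on {x..x + e} (g \<circ> f)) \<and>
     (\<exists>e>0. dyadic_affine_on {x - e..x} (g \<circ> f)) \<and>
     (x \<notin> dyadic_rationals \<longrightarrow> (\<exists>e>0. dyadic_affine_on {x - e..x + e} (g \<circ> f)))"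
    using e(1) e1(4) e2(4) locally_dyadic_dyadic[OF f(1), of x]
      comp[OF 2(1) e1(2) 1(1) e2(2)] comp[OF 2(2) e1(3) 1(2) e2(3)] comp[OF 2(3) _ 1(3)]
    by auto
qed

lemma strict_mono_image_Icc:
  fixes f :: "real \<Rightarrow> real"
  assumes "strict_mono f" "surj f"
  shows "f ` {a..b} = {f a..f b}"
proof
  show "f ` {a..b} \<subseteq> {f a..f b}"
    using assms strict_mono_less_eq by fastforce
  show "{f a..f b} \<subseteq> f ` {a..b}"
  proof
    fix y assume "y \<in> {f a..f b}"
    moreover obtain x where "y = f x" using assms(2) by blast
    ultimately show "y \<in> f ` {a..b}"
      using strict_mono_less_eq[OF assms(1)] by auto
  qed
qed

lemma locally_dyadic_inv:
  assumes f: "locally_dyadic f" "strict_mono f" "surj f"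
  shows "locally_dyadic (finv f)"
  unfolding locally_dyadic_def
proof
  fix y
  obtain x where y: "y = f x" using f(3) by blast
  obtain e where e: "e > 0" "dyadic_affine_on {x..x + e} f" "dyadic_affine_on {x - e..x} f"
    "x \<notin> dyadic_rationals \<Longrightarrow> dyadic_affine_on {x - e..x + e} f"
    using locally_dyadic_uniform_radius[OF f(1)] by metis
  \<comment> \<open>The images of the two one-sided intervals may differ in length; the smaller
    length is a radius on both sides of \<open>y\<close>.\<close>
  define d where "d = min (f (x + e) - f x) (f x - f (x - e))"
  have d: "d > 0" using e(1) strict_monoD[OF f(2)] by (simp add: d_def)
  have inj: "inj f" using f(2) strict_mono_imp_inj_on by blast
  have "dyadic_affine_on {f x..f (x + e)} (finv f)" "dyadic_affine_on {f (x - e)..f x} (finv f)"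
    "x \<notin> dyadic_rationals \<Longrightarrow> dyadic_affine_on {f (x - e)..f (x + e)} (finv f)"
    using e dyadic_affine_on_inv[OF _ inj] strict_mono_image_Icc[OF f(2,3)] by metis+
  moreover have "{y..y + d} \<subseteq> {f x..f (x + e)}" "{y - d..y} \<subseteq> {f (x - e)..f x}"
     "{y - d..y + d} \<subseteq> {f (x - e)..f (x + e)}"
    by (auto simp: y d_def)
  ultimately show "(\<exists>e>0. dyadic_affine_on {y..y + e} (finv f)) \<and>
     (\<exists>e>0. dyadic_affine_on {y - e..y} (finv f)) \<and>
     (y \<notin> dyadic_rationals \<longrightarrow> (\<exists>e>0. dyadic_affine_on {y - e..y + e} (finv f)))"
    using d locally_dyadic_dyadic[OF f(1), of x] y dyadic_affine_on_subset by blast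
qed

text \<open>Away from \<open>p\<close> the radius is shrunk so as not to reach across
  \<open>p\<close>. At \<open>p\<close> itself only one-sided germs are demanded, because
  \<open>p\<close> is dyadic.\<close>

lemma locally_dyadic_If:
  assumes f: "locally_dyadic f" and g: "locally_dyadic g"
    and p: "p \<in> dyadic_rationals" "f p = g p"
  shows "locally_dyadic (\<lambda>x. if x \<le> p then f x else g x)" (is "locally_dyadic ?h")
  unfolding locally_dyadic_def
proof
  fix x
  obtain e1 where e1: "e1 > 0" "dyadic_affine_on {x..x + e1} f" "dyadic_affine_on {x - e1..x} f"
    "x \<notin> dyadic_rationals \<Longrightarrow> dyadic_affine_on {x - e1..x + e1} f"
    using locally_dyadic_uniform_radius[OF f] by metis
  obtain e2 where e2: "e2 > 0" "dyadic_affine_on {x..x + e2} g" "dyadic_affine_on {x - e2..x} g"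
    "x \<notin> dyadic_rationals \<Longrightarrow> dyadic_affine_on {x - e2..x + e2} g"
    using locally_dyadic_uniform_radius[OF g] by metis
  have f_on: "dyadic_affine_on A ?h" if "A \<subseteq> B" "A \<subseteq> {..p}" "dyadic_affine_on B f" for A B
    
  proof -
    have "dyadic_affine_on A ?h \<longleftrightarrow> dyadic_affine_on A f"
      using that by (intro dyadic_affine_on_cong) auto
    then show ?thesis using that dyadic_affine_on_subset by blast
  qed
  have g_on: "dyadic_affine_on A ?h" if "A \<subseteq> B" "A \<subseteq> {p..}" "dyadic_affine_on B g" for A B
  proof -
    have "?h y = g y" if "y \<in> A" for y
    proof -
      have "y \<ge> p" using that \<open>A \<subseteq> {p..}\<close> by auto
      then show ?thesis using p(2) by (cases "y = p") auto
    qed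
    then have "dyadic_affine_on A ?h \<longleftrightarrow> dyadic_affine_on A g"
      by (rule dyadic_affine_on_cong)
    then show ?thesis using that dyadic_affine_on_subset by blast
  qed
  define P where "P e \<longleftrightarrow> e > 0 \<and> dyadic_affine_on {x..x + e} ?h \<and> dyadic_affine_on {x - e..x} ?h \<and>
     (x \<notin> dyadic_rationals \<longrightarrow> dyadic_affine_on {x - e..x + e} ?h)" for e
  have "\<exists>e. P e"
  proof (cases x p rule: linorder_cases)
    case less
    define e where "e = min e1 (p - x)"
    have "e > 0" "e \<le> e1" "x + e \<le> p" using less e1 by (auto simp: e_def)
    then have "P e"
      unfolding P_def using f_on[OF _ _ e1(2), of "{x..x + e}"] f_on[OF _ _ e1(3), of "{x - e..x}"]
        f_on[OF _ _ e1(4), of "{x - e..x + e}"] by auto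
    then show ?thesis ..
  next
    case equal
    define e where "e = min e1 e2"
    have "e > 0" "e \<le> e1" "e \<le> e2" using e1 e2 by (auto simp: e_def)
    then have "P e"
      unfolding P_def using g_on[OF _ _ e2(2), of "{x..x + e}"] f_on[OF _ _ e1(3), of "{x - e..x}"]
        equal p(1) by auto
    then show ?thesis ..
  next
    case greater
    define e where "e = min e2 (x - p)"
    have "e > 0" "e \<le> e2" "p \<le> x - e" using greater e2 by (auto simp: e_def)
    then have "P e"
      unfolding P_def using g_on[OF _ _ e2(2), of "{x..x + e}"] g_on[OF _ _ e2(3), of "{x - e..x}"]
        g_on[OF _ _ e2(4), of "{x - e..x + e}"] by auto
    then show ?thesis ..
  qed
  then show "(\<exists>e>0. dyadic_affine_on {x..x + e} ?h) \<and>
     (\<exists>e>0. dyadic_affine_on {x - e..x} ?h) \<and>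
     (x \<notin> dyadic_rationals \<longrightarrow> (\<exists>e>0. dyadic_affine_on {x - e..x + e} ?h))"
    unfolding P_def by blast
qed

section \<open>The Thompson group acting on the line\<close>

definition thompson_line :: "(real \<Rightarrow> real) set" where
  "thompson_line = {f. locally_dyadic f \<and> strict_mono f \<and> (\<forall>x. x \<notin> {0<..<1} \<longrightarrow> f x = x)}"

lemma thompson_line_outside: "f \<in> thompson_line \<Longrightarrow> x \<notin> {0<..<1} \<Longrightarrow> f x = x"
  by (auto simp: thompson_line_def)

lemma thompson_line_0: "f \<in> thompson_line \<Longrightarrow> f 0 = 0"
  and thompson_line_1: "f \<in> thompson_line \<Longrightarrow> f 1 = 1"
  by (auto simp: thompson_line_def)

lemma thompson_line_strict_mono: "f \<in> thompson_line \<Longrightarrow> strict_mono f"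
  by (auto simp: thompson_line_def)

lemma thompson_line_less_iff: "f \<in> thompson_line \<Longrightarrow> f x < f y \<longleftrightarrow> x < y"
  using strict_mono_less thompson_line_strict_mono by blast

lemma thompson_line_le_iff: "f \<in> thompson_line \<Longrightarrow> f x \<le> f y \<longleftrightarrow> x \<le> y"
  using strict_mono_less_eq thompson_line_strict_mono by blast

lemma thompson_line_eq_iff: "f \<in> thompson_line \<Longrightarrow> f x = f y \<longleftrightarrow> x = y"
  using strict_mono_eq thompson_line_strict_mono by blast

lemma thompson_line_isCont: "f \<in> thompson_line \<Longrightarrow> isCont f x"
  using locally_dyadic_isCont by (auto simp: thompson_line_def)

lemma thompson_line_Icc: "f \<in> thompson_line \<Longrightarrow> f x \<in> {0..1} \<longleftrightarrow> x \<in> {0..1}"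
  using thompson_line_le_iff[of f 0 x] thompson_line_le_iff[of f x 1]
  by (simp add: thompson_line_0 thompson_line_1)

lemma thompson_line_surj:
  assumes "f \<in> thompson_line"
  shows "surj f"
proof -
  have "\<exists>x. y = f x" for y
  proof (cases "y \<in> {0..1}")
    case True
    then have "\<exists>x\<ge>0. x \<le> 1 \<and> f x = y"
      using assms by (intro IVT) (auto simp: thompson_line_0 thompson_line_1 intro: thompson_line_isCont)
    then show ?thesis by blast
  next
    case False
    then show ?thesis using thompson_line_outside[OF assms, of y] by (intro exI[of _ y]) auto
  qed
  then show ?thesis by blast
qed

lemma thompson_line_bij: "f \<in> thompson_line \<Longrightarrow> bij f"
  by (simp add: bijI strict_mono_imp_inj_on thompson_line_strict_mono thompson_line_surj)

lemma inv_thompson_line_apply [simp]: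
  "f \<in> thompson_line \<Longrightarrow> finv f (f x) = x" "f \<in> thompson_line \<Longrightarrow> f (finv f x) = x"
  using thompson_line_bij[of f] by (auto simp: bij_is_inj bij_is_surj surj_f_inv_f)

lemma comp_inv_thompson_line [simp]:
  "f \<in> thompson_line \<Longrightarrow> finv f \<circ> f = id" "f \<in> thompson_line \<Longrightarrow> f \<circ> finv f = id"
  by (simp_all add: fun_eq_iff)

lemma thompson_line_id [simp]: "id \<in> thompson_line"
  using dyadic_affine_locally_dyadic[OF dyadic_affine_id]
  by (simp add: thompson_line_def strict_mono_def id_def)

lemma thompson_line_comp [simp, intro]:
  assumes "f \<in> thompson_line" "g \<in> thompson_line"
  shows "f \<circ> g \<in> thompson_line"
  using assms locally_dyadic_comp[of g f]
  by (auto simp: thompson_line_def strict_mono_mono strict_mono_o)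

lemma thompson_line_inv [simp, intro]:
  assumes "f \<in> thompson_line"
  shows "finv f \<in> thompson_line"
proof -
  have "strict_mono (finv f)"
  proof (rule strict_monoI)
    fix x y :: real
    assume "x < y"
    then show "finv f x < finv f y"
      using thompson_line_less_iff[OF assms, of "finv f x" "finv f y"] assms by simp
  qed
  moreover have "finv f x = x" if "x \<notin> {0<..<1}" for x
    using thompson_line_outside[OF assms that] inv_thompson_line_apply(1)[OF assms, of x] by simp
  moreover have "locally_dyadic (finv f)"
    using assms locally_dyadic_inv thompson_line_surj by (simp add: thompson_line_def)
  ultimately show ?thesis by (simp add: thompson_line_def)
qed

definition thompson_line_group :: "(real \<Rightarrow> real) monoid" where
  "thompson_line_group = \<lparr>carrier = thompson_line, mult = (\<circ>), one = id\<rparr>"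

lemma thompson_line_group_simps [simp]:
  "carrier thompson_line_group = thompson_line"
  "f \<otimes>\<^bsub>thompson_line_group\<^esub> g = f \<circ> g"
  "\<one>\<^bsub>thompson_line_group\<^esub> = id"
  by (simp_all add: thompson_line_group_def)

lemma group_thompson_line_group: "group thompson_line_group"
proof (rule groupI)
  fix f assume "f \<in> carrier thompson_line_group"
  then show "\<exists>g\<in>carrier thompson_line_group. g \<otimes>\<^bsub>thompson_line_group\<^esub> f = \<one>\<^bsub>thompson_line_group\<^esub>"
    by (intro bexI[of _ "finv f"]) auto
qed (auto simp: comp_assoc)

interpretation thompson_line: group thompson_line_group
  by (rule group_thompson_line_group)

lemma inv_thompson_line_group [simp]:
  "f \<in> thompson_line \<Longrightarrow> inv\<^bsub>thompson_line_group\<^esub> f = finv f"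
  by (rule thompson_line.inv_equality) auto

section \<open>Restriction to the unit interval\<close>

text \<open>Derivatives within a nondegenerate closed interval are unique even at its end points,
  which covers the one-sided slopes at 0 and 1 and at break points.\<close>

lemma affine_slope_unique:
  assumes D: "(f has_real_derivative D) (at x within S)"
    and ab: "a < b" "{a..b} \<subseteq> S" "x \<in> {a..b}"
    and f: "\<And>y. y \<in> {a..b} \<Longrightarrow> f y = m * y + c"
  shows "D = m"
proof -
  have 1: "(f has_real_derivative D) (at x within {a..b})"
    using D ab has_field_derivative_subset by blast
  have "((\<lambda>y. m * y + c) has_real_derivative m) (at x within {a..b})"
    by (auto intro!: derivative_eq_intros)
  then have 2: "(f has_real_derivative m) (at x within {a..b})"
    by (rule has_field_derivative_transform_within[of _ _ _ _ 1]) (use ab f in auto)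
  show ?thesis
    using vector_derivative_unique_within_closed_interval[of a b x f D m] ab 1 2
    by (simp add: has_real_derivative_iff_has_vector_derivative)
qed

lemma dyadic_affine_on_has_derivative:
  assumes "dyadic_affine_on {a..b} f" "a < x" "x < b"
  obtains k :: int where "(f has_real_derivative 2 powi k) (at x)"
proof -
  obtain k d where f: "\<And>y. y \<in> {a..b} \<Longrightarrow> f y = 2 powi k * y + d"
    using assms by (auto simp: dyadic_affine_on_def dyadic_affine_def)
  have "((\<lambda>y. 2 powi k * y + d) has_real_derivative 2 powi k) (at x)"
    by (auto intro!: derivative_eq_intros)
  then have "(f has_real_derivative 2 powi k) (at x)"
    by (rule has_field_derivative_transform_within_open[of _ _ _ "{a<..<b}"]) (use assms f in auto)
  then show thesis by (rule that)
qed

lemma piecewise_linear_on_affine: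
  assumes "a < b" "\<And>x. x \<in> {a..b} \<Longrightarrow> f x = m * x + c"
  shows "piecewise_linear_on a b f"
  unfolding piecewise_linear_on_def
  by (rule exI[of _ 1], rule exI[of _ "\<lambda>i. if i = 0 then a else b"]) (use assms in auto)

lemma piecewise_linear_on_join:
  assumes "piecewise_linear_on a b f" "piecewise_linear_on b c f"
  shows "piecewise_linear_on a c f"
proof -
  obtain n t where t: "t 0 = a" "t n = b"
    "\<And>i. i < n \<Longrightarrow> t i < t (Suc i) \<and> (\<exists>m c. \<forall>x\<in>{t i..t (Suc i)}. f x = m * x + c)"
    using assms(1) by (auto simp: piecewise_linear_on_def)
  obtain n' t' where t': "t' 0 = b" "t' n' = c"
    "\<And>i. i < n' \<Longrightarrow> t' i < t' (Suc i) \<and> (\<exists>m c. \<forall>x\<in>{t' i..t' (Suc i)}. f x = m * x + c)"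
    using assms(2) by (auto simp: piecewise_linear_on_def)
  define s where "s i = (if i \<le> n then t i else t' (i - n))" for i
  have "s i < s (Suc i) \<and> (\<exists>m c. \<forall>x\<in>{s i..s (Suc i)}. f x = m * x + c)" if "i < n + n'" for i
  proof (cases i n rule: linorder_cases)
    case less
    then have "s i = t i" "s (Suc i) = t (Suc i)" by (auto simp: s_def)
    then show ?thesis using t(3)[OF less] by simp
  next
    case equal
    then have "s i = t' 0" "s (Suc i) = t' (Suc 0)" by (auto simp: s_def t t')
    then show ?thesis using t'(3)[of 0] that equal by simp
  next
    case greater
    then have "s i = t' (i - n)" "s (Suc i) = t' (Suc (i - n))" by (auto simp: s_def Suc_diff_le)
    then show ?thesis using t'(3)[of "i - n"] that greater by simp
  qed
  moreover have "s 0 = a" "s (n + n') = c"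
    using t t' by (auto simp: s_def)
  ultimately show ?thesis
    unfolding piecewise_linear_on_def by blast
qed

text \<open>Compactness by bisection: adjacent intervals are joined, and a short interval around
  \<open>x\<close> is cut at \<open>x\<close> into at most two affine pieces.\<close>

lemma locally_dyadic_piecewise_linear:
  assumes f: "locally_dyadic f" and "a < b"
  shows "piecewise_linear_on a b f"
proof -
  have "a < b \<longrightarrow> piecewise_linear_on a b f"
    using less_imp_le[OF \<open>a < b\<close>]
  proof (induction rule: Bolzano)
    case (trans a b c)
    then show ?case using piecewise_linear_on_join[of a b f c] by (cases "a = b"; cases "b = c") simp_all
  next
    case (local x)
    obtain e where e: "e > 0" "dyadic_affine_on {x..x + e} f" "dyadic_affine_on {x - e..x} f"
      using locally_dyadic_uniform_radius[OF f] by metis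
    have aff: "piecewise_linear_on u v f"
      if "u < v" "{u..v} \<subseteq> {x..x + e} \<or> {u..v} \<subseteq> {x - e..x}" for u v
    proof -
      have "dyadic_affine_on {u..v} f" using that e dyadic_affine_on_subset by blast
      then obtain m c where "\<And>y. y \<in> {u..v} \<Longrightarrow> f y = m * y + c"
        unfolding dyadic_affine_on_def dyadic_affine_def by auto
      then show ?thesis using piecewise_linear_on_affine that by blast
    qed
    have "u < v \<longrightarrow> piecewise_linear_on u v f" if uv: "u \<le> x \<and> x \<le> v \<and> v - u < e" for u v
    proof
      assume "u < v"
      have "x < v \<Longrightarrow> piecewise_linear_on x v f" "u < x \<Longrightarrow> piecewise_linear_on u x f"
        using uv by (auto intro!: aff)
      then show "piecewise_linear_on u v f"
        using uv \<open>u < v\<close> piecewise_linear_on_join[of u x f v] by (cases "u = x"; cases "x = v") simp_all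
    qed
    then show ?case using e(1) by blast
  qed
  then show ?thesis using assms by simp
qed

lemma locally_dyadic_finite_nondifferentiable:
  assumes f: "locally_dyadic f" and "a \<le> b"
  shows "finite {x \<in> {a..b}. \<not> f differentiable (at x)}"
  using \<open>a \<le> b\<close>
proof (induction rule: Bolzano)
  case (trans a b c)
  have "{x \<in> {a..c}. \<not> f differentiable (at x)} \<subseteq>
      {x \<in> {a..b}. \<not> f differentiable (at x)} \<union> {x \<in> {b..c}. \<not> f differentiable (at x)}"
    by auto
  then show ?case using trans finite_subset by blast
next
  case (local x)
  obtain e where e: "e > 0" "dyadic_affine_on {x..x + e} f" "dyadic_affine_on {x - e..x} f"
    using locally_dyadic_uniform_radius[OF f] by metis
  have diff: "f differentiable (at y)" if "x - e < y" "y < x + e" "y \<noteq> x" for y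
  proof (cases "y < x")
    case True
    then show ?thesis
      using that dyadic_affine_on_has_derivative[OF e(3), of y] real_differentiable_def by metis
  next
    case False
    then show ?thesis
      using that dyadic_affine_on_has_derivative[OF e(2), of y] real_differentiable_def
      by (meson linorder_neqE_linordered_idom)
  qed
  have "finite {y \<in> {u..v}. \<not> f differentiable (at y)}" if "u \<le> x \<and> x \<le> v \<and> v - u < e" for u v
  proof -
    have "{y \<in> {u..v}. \<not> f differentiable (at y)} \<subseteq> {x}"
      using that diff by force
    then show ?thesis using finite_subset by blast
  qed
  then show ?case using e(1) by blast
qed

lemma thompson_F_carrier_restrict:
  assumes f: "f \<in> thompson_line"
  shows "restrict f {0..1} \<in> thompson_F_carrier"
proof -
  let ?g = "restrict f {0..1}"
  have loc: "locally_dyadic f" using f by (simp add: thompson_line_def)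
  have image: "f ` {0..1} = {0..1}" if "f \<in> thompson_line" for f
    using that strict_mono_image_Icc[of f 0 1]
    by (simp add: thompson_line_strict_mono thompson_line_surj thompson_line_0 thompson_line_1)
  have cont: "continuous_on {0..1} (restrict f {0..1})" if "f \<in> thompson_line" for f
  proof -
    have "continuous_on {0..1} f"
      using that thompson_line_isCont continuous_at_imp_continuous_on by blast
    then show ?thesis by (rule continuous_on_eq) simp
  qed
  have 1: "homeomorphism {0..1} {0..1} ?g (restrict (finv f) {0..1})"
    unfolding homeomorphism_def
    using f image[OF f] image[OF thompson_line_inv[OF f]] cont[OF f] cont[OF thompson_line_inv[OF f]]
      thompson_line_Icc[OF f] thompson_line_Icc[OF thompson_line_inv[OF f]]
    by auto
  have 2: "strict_mono_on {0..1} ?g"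
    using f by (auto simp: strict_mono_on_def thompson_line_less_iff)
  have 3: "piecewise_linear_on 0 1 ?g"
  proof -
    have "piecewise_linear_on 0 1 f"
      using locally_dyadic_piecewise_linear[OF loc] by simp
    then obtain n t where t: "t 0 = 0" "t n = 1"
      "\<And>i. i < n \<Longrightarrow> t i < t (Suc i)"
      "\<And>i. i < n \<Longrightarrow> (\<exists>m c. \<forall>x\<in>{t i..t (Suc i)}. f x = m * x + c)"
      by (auto simp: piecewise_linear_on_def)
    have "t i \<le> t j" if "i \<le> j" "j \<le> n" for i j
      using that
    proof (induction j rule: dec_induct)
      case (step j)
      then show ?case using t(3)[of j] by simp
    qed simp
    then have "{t i..t (Suc i)} \<subseteq> {0..1}" if "i < n" for i
      using that t(1,2) by (metis Suc_leI atLeastatMost_subset_iff le0 order_refl less_imp_le)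
    then have "\<exists>m c. \<forall>x\<in>{t i..t (Suc i)}. ?g x = m * x + c" if "i < n" for i
      using t(4)[OF that] that by (metis restrict_apply' subsetD)
    then show ?thesis
      using t unfolding piecewise_linear_on_def by blast
  qed
  have within: "?g differentiable (at x within {0..1})" if "f differentiable (at x)" "x \<in> {0..1}" for x
  proof -
    have "f differentiable (at x within {0..1})"
      using that differentiable_at_withinI by blast
    then show ?thesis
      by (rule differentiable_transform_within[of _ _ _ 1]) (use that in auto)
  qed
  have 4: "finite {x \<in> {0..1}. \<not> ?g differentiable (at x within {0..1})}"
    by (rule finite_subset[OF _ locally_dyadic_finite_nondifferentiable[OF loc, of 0 1]])
      (use within in auto)
  have 5: "{x \<in> {0..1}. \<not> ?g differentiable (at x within {0..1})} \<subseteq> dyadic_rationals"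
  proof clarify
    fix x :: real assume x: "x \<in> {0..1}" "\<not> ?g differentiable (at x within {0..1})"
    obtain e where e: "e > 0" "x \<notin> dyadic_rationals \<Longrightarrow> dyadic_affine_on {x - e..x + e} f"
      using locally_dyadic_uniform_radius[OF loc] by metis
    show "x \<in> dyadic_rationals"
    proof (rule ccontr)
      assume "x \<notin> dyadic_rationals"
      then have "f differentiable (at x)"
        using e dyadic_affine_on_has_derivative[of "x - e" "x + e" f x] real_differentiable_def
        by (metis diff_less_eq less_add_same_cancel1)
      then show False using within x by blast
    qed
  qed
  have 6: "\<exists>n :: int. m = 2 powi n"
    if x: "x \<in> {0..1}" and m: "(?g has_real_derivative m) (at x within {0..1})" for x m
  proof -
    obtain e where e: "e > 0" "dyadic_affine_on {x..x + e} f" "dyadic_affine_on {x - e..x} f"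
      using locally_dyadic_uniform_radius[OF loc] by metis
    \<comment> \<open>At 1 the interval has to lie to the left of \<open>x\<close>; everywhere else
      there is room on the right.\<close>
    have "\<exists>a b. a < b \<and> {a..b} \<subseteq> {0..1} \<and> x \<in> {a..b} \<and> dyadic_affine_on {a..b} f"
    proof (cases "x < 1")
      case True
      then show ?thesis
        using e x by (intro exI[of _ x] exI[of _ "min 1 (x + e)"])
          (auto intro: dyadic_affine_on_subset[OF e(2)])
    next
      case False
      then show ?thesis
        using e x by (intro exI[of _ "max 0 (x - e)"] exI[of _ x])
          (auto intro: dyadic_affine_on_subset[OF e(3)])
    qed
    then obtain a b where ab: "a < b" "{a..b} \<subseteq> {0..1}" "x \<in> {a..b}" "dyadic_affine_on {a..b} f"
      by blast
    then obtain k d where "\<And>y. y \<in> {a..b} \<Longrightarrow> f y = 2 powi k * y + d"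
      unfolding dyadic_affine_on_def dyadic_affine_def by auto
    then have "\<And>y. y \<in> {a..b} \<Longrightarrow> ?g y = 2 powi k * y + d"
      using ab(2) by auto
    then show ?thesis using affine_slope_unique[OF m ab(1-3)] by blast
  qed
  show ?thesis
    using 1 2 3 4 5 6 unfolding thompson_F_carrier_def by blast
qed

text \<open>Only slopes and break points are given; the translation parts turn out dyadic by walking
  along the partition, starting from the value 0 at 0. A partition point need not be a break point,
  so a non-dyadic one has to be recognised as spurious.\<close>

lemma thompson_F_carrier_extend:
  assumes g: "g \<in> thompson_F_carrier"
  shows "(\<lambda>x. if x \<in> {0..1} then g x else x) \<in> thompson_line" (is "?f \<in> _")
proof -
  have mono: "strict_mono_on {0..1} g" and "piecewise_linear_on 0 1 g"
    and sing: "\<And>x. x \<in> {0..1} \<Longrightarrow> x \<notin> dyadic_rationals \<Longrightarrow> g differentiable (at x within {0..1})"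
    and slope: "\<And>x m. x \<in> {0..1} \<Longrightarrow> (g has_real_derivative m) (at x within {0..1}) \<Longrightarrow> \<exists>n::int. m = 2 powi n"
    using g unfolding thompson_F_carrier_def by auto
  obtain g' where "homeomorphism {0..1} {0..1} g g'"
    using g unfolding thompson_F_carrier_def by auto
  then have img: "g ` {0..1} = {0..1}" by (simp add: homeomorphism_image1)
  have le: "g x \<le> g y" if "x \<in> {0..1}" "y \<in> {0..1}" "x \<le> y" for x y
    using mono that by (auto simp: strict_mono_on_def le_less)
  obtain u v where uv: "u \<in> {0..1}" "v \<in> {0..1}" "g u = 0" "g v = 1"
  proof -
    have "0 \<in> g ` {0..1}" "1 \<in> g ` {0..1}" unfolding img by simp_all
    then show thesis using that by (metis imageE)
  qed
  have in01: "g x \<in> {0..1}" if "x \<in> {0..1}" for x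
    using img that by blast
  have ends: "g 0 = 0" "g 1 = 1"
    using le[of 0 u] le[of v 1] uv in01[of 0] in01[of 1] by auto
  obtain n t where t: "t 0 = 0" "t n = 1"
    "\<And>i. i < n \<Longrightarrow> t i < t (Suc i)"
    and "\<forall>i<n. \<exists>m c. \<forall>x\<in>{t i..t (Suc i)}. g x = m * x + c"
    using \<open>piecewise_linear_on 0 1 g\<close> by (auto simp: piecewise_linear_on_def)
  then obtain m c where lin: "\<And>i x. i < n \<Longrightarrow> x \<in> {t i..t (Suc i)} \<Longrightarrow> g x = m i * x + c i"
    by metis
  have t_le: "t i \<le> t j" if "i \<le> j" "j \<le> n" for i j
    using that
  proof (induction j rule: dec_induct)
    case (step j)
    then show ?case using t(3)[of j] by simp
  qed simp
  have sub: "{t i..t (Suc i)} \<subseteq> {0..1}" if "i < n" for i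
    using t_le[of 0 i] t_le[of "Suc i" n] that t(1,2) by auto
  \<comment> \<open>The slope of a piece is read off at its midpoint, where the derivative exists on
    both sides.\<close>
  have m: "\<exists>k::int. m i = 2 powi k" if i: "i < n" for i
  proof -
    define x where "x = (t i + t (Suc i)) / 2"
    have x: "t i < x" "x < t (Suc i)" using t(3)[OF i] by (auto simp: x_def)
    have "((\<lambda>y. m i * y + c i) has_real_derivative m i) (at x)"
      by (auto intro!: derivative_eq_intros)
    then have "(g has_real_derivative m i) (at x)"
      by (rule has_field_derivative_transform_within_open[of _ _ _ "{t i<..<t (Suc i)}"])
        (use x lin[OF i] in auto)
    moreover have "x \<in> {0..1}" using x sub[OF i] by auto
    ultimately show ?thesis using slope has_field_derivative_at_within by blast
  qed
  \<comment> \<open>Differentiability at a non-dyadic partition point makes the slopes on both sides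
    equal, and the common value there makes the constants equal.\<close>
  have smooth: "m i = m (Suc i) \<and> c i = c (Suc i)"
    if i: "Suc i < n" and p: "t (Suc i) \<notin> dyadic_rationals" for i
  proof -
    let ?p = "t (Suc i)"
    have lt: "t i < ?p" "?p < t (Suc (Suc i))" using t(3)[of i] t(3)[of "Suc i"] i by auto
    have "?p \<in> {0..1}" using sub[OF i] lt by auto
    then obtain D where D: "(g has_real_derivative D) (at ?p within {0..1})"
      using sing p real_differentiable_def by blast
    have "D = m i"
      by (rule affine_slope_unique[OF D lt(1) sub, of "m i" "c i"]) (use lt i lin in auto)
    moreover have "D = m (Suc i)"
      by (rule affine_slope_unique[OF D lt(2) sub, of "m (Suc i)" "c (Suc i)"]) (use lt i lin in auto)
    moreover have "m i * ?p + c i = m (Suc i) * ?p + c (Suc i)"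
      using lin[of i ?p] lin[of "Suc i" ?p] lt i by auto
    ultimately show ?thesis by simp
  qed
  \<comment> \<open>Across a dyadic point, continuity expresses the new constant by dyadic numbers;
    across any other point the constant does not change.\<close>
  have c: "i < n \<Longrightarrow> c i \<in> dyadic_rationals" for i
  proof (induction i)
    case 0
    then have "c 0 = 0" using lin[of 0 0] t(1) t(3)[of 0] ends by simp
    then show ?case by simp
  next
    case (Suc i)
    let ?p = "t (Suc i)"
    show ?case
    proof (cases "?p \<in> dyadic_rationals")
      case True
      have "m i * ?p + c i = m (Suc i) * ?p + c (Suc i)"
        using lin[of i ?p] lin[of "Suc i" ?p] t(3)[of i] t(3)[of "Suc i"] Suc by auto
      then have "c (Suc i) = m i * ?p + c i - m (Suc i) * ?p" by simp
      moreover obtain k k' :: int where "m i = 2 powi k" "m (Suc i) = 2 powi k'"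
        using m[of i] m[of "Suc i"] Suc.prems by auto
      ultimately show ?thesis using Suc True by auto
    next
      case False
      then show ?thesis using smooth Suc by force
    qed
  qed
  have on: "dyadic_affine_on A ?f" if i: "i < n" "A \<subseteq> {t i..t (Suc i)}" for i A
  proof -
    obtain k :: int where "m i = 2 powi k" using m[OF i(1)] by blast
    then have "\<forall>x\<in>A. ?f x = 2 powi k * x + c i"
      using lin[OF i(1)] sub[OF i(1)] i(2) by auto
    then show ?thesis
      unfolding dyadic_affine_on_def using dyadic_affineI[OF c[OF i(1)]] by blast
  qed
  have on_id: "dyadic_affine_on A ?f" if "A \<subseteq> {..0} \<or> A \<subseteq> {1..}" for A
  proof -
    have "\<forall>x\<in>A. ?f x = x"
    proof
      fix x assume "x \<in> A"
      then have "x \<notin> {0..1} \<or> x = 0 \<or> x = 1" using that by auto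
      then show "?f x = x" using ends by auto
    qed
    then show ?thesis unfolding dyadic_affine_on_def using dyadic_affine_id by blast
  qed
  have piece: "\<exists>i<k. t i \<le> x \<and> x < t (Suc i)" if "t 0 \<le> x" "x < t k" for k x
    using that
  proof (induction k)
    case (Suc k)
    then show ?case by (cases "x < t k") (use less_Suc_eq in auto)
  qed simp
  have piece': "\<exists>i<k. t i < x \<and> x \<le> t (Suc i)" if "t 0 < x" "x \<le> t k" for k x
    using that
  proof (induction k)
    case (Suc k)
    then show ?case by (cases "x \<le> t k") (use less_Suc_eq in auto)
  qed simp
  have "locally_dyadic ?f"
    unfolding locally_dyadic_def
  proof (intro allI conjI impI)
    fix x
    consider "x < 0" | "x \<ge> 1" | i where "i < n" "t i \<le> x" "x < t (Suc i)"
      using piece[of x n] t(1,2) by fastforce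
    then show "\<exists>e>0. dyadic_affine_on {x..x + e} ?f"
    proof cases
      case 1
      then show ?thesis by (intro exI[of _ "- x"] conjI on_id) auto
    next
      case 2
      then show ?thesis by (intro exI[of _ 1] conjI on_id) auto
    next
      case 3
      then show ?thesis by (intro exI[of _ "t (Suc i) - x"] conjI on[of i]) auto
    qed
    consider "x \<le> 0" | "x > 1" | i where "i < n" "t i < x" "x \<le> t (Suc i)"
      using piece'[of x n] t(1,2) by fastforce
    then show "\<exists>e>0. dyadic_affine_on {x - e..x} ?f"
    proof cases
      case 1
      then show ?thesis by (intro exI[of _ 1] conjI on_id) auto
    next
      case 2
      then show ?thesis by (intro exI[of _ "x - 1"] conjI on_id) auto
    next
      case 3
      then show ?thesis by (intro exI[of _ "x - t i"] conjI on[of i]) auto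
    qed
    assume x: "x \<notin> dyadic_rationals"
    then have "x \<noteq> 0" "x \<noteq> 1" by auto
    then consider "x < 0" | "x > 1" | i where "i < n" "t i \<le> x" "x < t (Suc i)"
      using piece[of x n] t(1,2) by fastforce
    then show "\<exists>e>0. dyadic_affine_on {x - e..x + e} ?f"
    proof cases
      case 1
      then show ?thesis by (intro exI[of _ "- x"] conjI on_id) auto
    next
      case 2
      then show ?thesis by (intro exI[of _ "x - 1"] conjI on_id) auto
    next
      case 3
      show ?thesis
      proof (cases "t i = x")
        case False
        define e where "e = min (x - t i) (t (Suc i) - x)"
        have "e > 0" "{x - e..x + e} \<subseteq> {t i..t (Suc i)}" using 3 False by (auto simp: e_def)
        then show ?thesis using on[OF 3(1)] by blast
      next
        case True
        then have "i \<noteq> 0" using t(1) \<open>x \<noteq> 0\<close> by metis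
        then obtain j where j: "i = Suc j" using not0_implies_Suc by blast
        \<comment> \<open>The point \<open>x\<close> is a non-dyadic partition point, so the pieces
          on its two sides belong to one affine map and can be merged.\<close>
        have eq: "m j = m i \<and> c j = c i" using smooth[of j] 3 x True j by auto
        have tj: "t j < x" using t(3)[of j] 3 j True by auto
        define e where "e = min (x - t j) (t (Suc i) - x)"
        have e: "e > 0" "{x - e..x + e} \<subseteq> {t j..t i} \<union> {t i..t (Suc i)}"
          using 3 tj True by (auto simp: e_def)
        obtain k :: int where k: "m i = 2 powi k" using m 3(1) by blast
        have "?f y = 2 powi k * y + c i" if y: "y \<in> {x - e..x + e}" for y
        proof -
          have "y \<in> {0..1}" using y e(2) sub[of j] sub[of i] 3(1) j by auto
          moreover have "g y = m i * y + c i"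
            using y e(2) lin[of j y] lin[of i y] 3(1) j eq by auto
          ultimately show ?thesis using k by simp
        qed
        then have "dyadic_affine_on {x - e..x + e} ?f"
          unfolding dyadic_affine_on_def using dyadic_affineI[OF c[OF 3(1)]] by blast
        then show ?thesis using e(1) by blast
      qed
    qed
  qed
  moreover have "strict_mono ?f"
  proof (rule strict_monoI)
    fix x y :: real assume "x < y"
    then show "?f x < ?f y"
      using mono in01[of x] in01[of y] le[of 0 y] le[of x 1] strict_mono_onD[OF mono, of x y] by auto
  qed
  moreover have "?f x = x" if "x \<notin> {0<..<1}" for x
    using ends that by (cases "x = 0"; cases "x = 1") auto
  ultimately show ?thesis by (simp add: thompson_line_def)
qed

lemma thompson_F_iso: "(\<lambda>f. restrict f {0..1}) \<in> iso thompson_line_group thompson_F"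
proof -
  have Bij: "restrict f {0..1} \<in> Bij {0..1}" if "f \<in> thompson_line" for f
  proof -
    have "bij_betw (restrict f {0..1}) {0..1} {0..1}"
      using strict_mono_image_Icc[of f 0 1] that
      by (auto simp: bij_betw_def inj_on_def thompson_line_eq_iff thompson_line_strict_mono
          thompson_line_surj thompson_line_0 thompson_line_1)
    then show ?thesis by (simp add: Bij_def)
  qed
  have "restrict (f \<circ> g) {0..1} = compose {0..1} (restrict f {0..1}) (restrict g {0..1})"
    if "f \<in> thompson_line" "g \<in> thompson_line" for f g
    using thompson_line_Icc[OF that(2)] by (auto simp: compose_def fun_eq_iff)
  then have "(\<lambda>f. restrict f {0..1}) \<in> hom thompson_line_group thompson_F"
    using Bij thompson_F_carrier_restrict by (auto simp: hom_def thompson_F_def BijGroup_def)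
  moreover have "inj_on (\<lambda>f. restrict f {0..1::real}) thompson_line"
  proof (rule inj_onI, rule ext)
    fix f g :: "real \<Rightarrow> real" and x
    assume fg: "f \<in> thompson_line" "g \<in> thompson_line" "restrict f {0..1} = restrict g {0..1}"
    show "f x = g x"
    proof (cases "x \<in> {0..1}")
      case True
      then show ?thesis using fg(3) by (metis restrict_apply')
    next
      case False
      then show ?thesis using thompson_line_outside[OF fg(1), of x] thompson_line_outside[OF fg(2), of x] by auto
    qed
  qed
  moreover have "\<exists>f\<in>thompson_line. g = restrict f {0..1}" if "g \<in> thompson_F_carrier" for g
  proof (rule bexI[OF _ thompson_F_carrier_extend[OF that]])
    show "g = restrict (\<lambda>x. if x \<in> {0..1} then g x else x) {0..1}"
      using that by (auto simp: thompson_F_carrier_def fun_eq_iff extensional_def)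
  qed
  ultimately show ?thesis
    using thompson_F_carrier_restrict by (auto simp: iso_def bij_betw_def thompson_F_def)
qed

lemma group_thompson_F: "group thompson_F"
proof -
  have "\<one>\<^bsub>thompson_F\<^esub> = restrict (\<one>\<^bsub>thompson_line_group\<^esub>) {0..1}"
    by (simp add: thompson_F_def BijGroup_def fun_eq_iff)
  \<comment> \<open>\<open>iso_imp_img_group\<close> speaks of the record whose unit is replaced by
    the image of the unit; here this replacement changes nothing.\<close>
  then have "thompson_F = thompson_F\<lparr>one := restrict (\<one>\<^bsub>thompson_line_group\<^esub>) {0..1}\<rparr>"
    by simp
  then show ?thesis
    using thompson_line.iso_imp_img_group[OF thompson_F_iso] by simp
qed

section \<open>Generation by binary trees\<close>

text \<open>Conjugation by \<open>\<lambda>x. a + l * x\<close>, which carries the unit interval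
  onto \<open>[a, a + l]\<close>; the second argument is a length, not an end point.\<close>

definition rescale :: "real \<Rightarrow> real \<Rightarrow> (real \<Rightarrow> real) \<Rightarrow> real \<Rightarrow> real" where
  "rescale a l f = (\<lambda>x. a + l * f ((x - a) / l))"

lemma rescale_apply: "l \<noteq> 0 \<Longrightarrow> rescale a l f (a + l * x) = a + l * f x"
  by (simp add: rescale_def)

lemma rescale_comp: "l \<noteq> 0 \<Longrightarrow> rescale a l f \<circ> rescale a l g = rescale a l (f \<circ> g)"
  by (simp add: rescale_def fun_eq_iff)

lemma rescale_id: "l \<noteq> 0 \<Longrightarrow> rescale a l id = id"
  by (simp add: rescale_def fun_eq_iff)

lemma rescale_rescale:
  assumes "l \<noteq> 0" "m \<noteq> 0"
  shows "rescale a l (rescale b m f) = rescale (a + l * b) (l * m) f"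
proof -
  have "((x - a) / l - b) / m = (x - (a + l * b)) / (l * m)" for x
    using assms by (simp add: field_simps)
  then show ?thesis by (simp add: rescale_def fun_eq_iff distrib_left)
qed

definition dyadic_subinterval :: "real \<Rightarrow> real \<Rightarrow> bool" where
  "dyadic_subinterval a l \<longleftrightarrow> a \<in> dyadic_rationals \<and> (\<exists>k::int. l = 2 powi k) \<and> 0 \<le> a \<and> a + l \<le> 1"

lemma dyadic_subintervalI:
  assumes "0 \<le> j" "j + 1 \<le> 2 ^ n"
  shows "dyadic_subinterval (of_int j / 2 ^ n) (1 / 2 ^ n)"
proof -
  have l: "1 / 2 ^ n = (2::real) powi (- int n)" by (simp add: power_int_minus field_simps)
  have "real_of_int (j + 1) \<le> real_of_int (2 ^ n)"
    using assms(2) by (simp only: of_int_le_iff)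
  then have "of_int j / 2 ^ n + 1 / 2 ^ n \<le> (1::real)" by (simp add: field_simps)
  then show ?thesis
    unfolding dyadic_subinterval_def using assms(1) l by (intro conjI exI[of _ "- int n"]) auto
qed

lemma dyadic_subinterval_basic [simp]:
  "dyadic_subinterval 0 (1/2)" "dyadic_subinterval (1/2) (1/2)"
  "dyadic_subinterval 0 (1/4)" "dyadic_subinterval (1/4) (1/4)" "dyadic_subinterval (1/2) (1/4)"
  using dyadic_subintervalI[of 0 1] dyadic_subintervalI[of 1 1] dyadic_subintervalI[of 0 2]
    dyadic_subintervalI[of 1 2] dyadic_subintervalI[of 2 2]
  by simp_all

lemma rescale_outside:
  assumes "f \<in> thompson_line" "l > 0" "x \<notin> {a<..<a + l}"
  shows "rescale a l f x = x"
proof -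
  have "x - a \<le> 0 \<or> l \<le> x - a" using assms(3) by auto
  then have "(x - a) / l \<notin> {0<..<1}"
    using assms(2) by (auto simp: divide_less_eq zero_less_divide_iff)
  then show ?thesis
    using thompson_line_outside[OF assms(1)] assms(2) by (simp add: rescale_def)
qed

lemma rescale_locally_dyadic:
  assumes f: "locally_dyadic f" "strict_mono f" and a: "a \<in> dyadic_rationals"
  shows "locally_dyadic (rescale a (2 powi k) f)" "strict_mono (rescale a (2 powi k) f)"
proof -
  let ?A = "\<lambda>x. 2 powi k * x + a" and ?B = "\<lambda>x. 2 powi (- k) * x + - (2 powi (- k) * a)"
  have AB: "dyadic_affine ?A" "dyadic_affine ?B"
    using a by (intro dyadic_affineI; blast)+
  have eq: "rescale a (2 powi k) f = (?A \<circ> f) \<circ> ?B"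
    by (simp add: rescale_def fun_eq_iff power_int_minus field_simps)
  have "locally_dyadic (?A \<circ> f)"
    by (rule locally_dyadic_comp[OF f(1) strict_mono_mono[OF f(2)] dyadic_affine_locally_dyadic[OF AB(1)]])
  then show "locally_dyadic (rescale a (2 powi k) f)"
    unfolding eq
    by (rule locally_dyadic_comp[OF dyadic_affine_locally_dyadic[OF AB(2)]
          strict_mono_mono[OF dyadic_affine_strict_mono[OF AB(2)]]])
  show "strict_mono (rescale a (2 powi k) f)"
    unfolding eq using strict_mono_o[OF strict_mono_o[OF dyadic_affine_strict_mono[OF AB(1)] f(2)]
        dyadic_affine_strict_mono[OF AB(2)]] .
qed

lemma rescale_thompson_line [simp, intro]:
  assumes f: "f \<in> thompson_line" and al: "dyadic_subinterval a l"
  shows "rescale a l f \<in> thompson_line"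
proof -
  obtain k :: int where l: "l = 2 powi k" and a: "a \<in> dyadic_rationals" "0 \<le> a" "a + l \<le> 1"
    using al by (auto simp: dyadic_subinterval_def)
  have "locally_dyadic (rescale a l f)" "strict_mono (rescale a l f)"
    using rescale_locally_dyadic[of f a k] f a unfolding l by (auto simp: thompson_line_def)
  moreover have "rescale a l f x = x" if "x \<notin> {0<..<1}" for x
    using that a l by (intro rescale_outside[OF f]) auto
  ultimately show ?thesis by (simp add: thompson_line_def)
qed

lemma finv_rescale:
  assumes "f \<in> thompson_line" "l \<noteq> 0"
  shows "finv (rescale a l f) = rescale a l (finv f)"
  by (rule inv_equality) (use assms in \<open>simp_all add: rescale_def\<close>)

text \<open>The inverse of the standard generator often called A. As a change of subdivision it is
  one tree rotation; as a map it moves every point of the open interval to the right, with slope 2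
  at 0 and 1/2 at 1.\<close>

definition x0 :: "real \<Rightarrow> real" where
  "x0 x = (if x \<le> 0 then x else if x \<le> 1/4 then 2 * x else if x \<le> 1/2 then x + 1/4
           else if x \<le> 1 then (x + 1) / 2 else x)"

lemma x0_thompson_line [simp, intro]: "x0 \<in> thompson_line"
proof -
  have D: "1/4 \<in> dyadic_rationals" "1/2 \<in> dyadic_rationals"
    using dyadic_of_int[of 1 2] dyadic_of_int[of 1 1] by simp_all
  have loc: "locally_dyadic (\<lambda>x. x)" "locally_dyadic (\<lambda>x. 2 * x)" "locally_dyadic (\<lambda>x. x + 1/4)"
    "locally_dyadic (\<lambda>x. (x + 1) / 2)"
    using dyadic_affineI[of 0 0] dyadic_affineI[of 0 1] dyadic_affineI[OF D(1), of 0]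
      dyadic_affineI[OF D(2), of "-1"]
    by (auto intro!: dyadic_affine_locally_dyadic simp: power_int_minus field_simps)
  have 1: "locally_dyadic (\<lambda>x::real. if x \<le> 1 then (x + 1) / 2 else x)"
    by (rule locally_dyadic_If) (use loc in auto)
  have 2: "locally_dyadic (\<lambda>x::real. if x \<le> 1/2 then x + 1/4 else if x \<le> 1 then (x + 1) / 2 else x)"
    by (rule locally_dyadic_If) (use loc 1 D in auto)
  have 3: "locally_dyadic (\<lambda>x::real. if x \<le> 1/4 then 2 * x else
      if x \<le> 1/2 then x + 1/4 else if x \<le> 1 then (x + 1) / 2 else x)"
    by (rule locally_dyadic_If) (use loc 2 D in auto)
  have "locally_dyadic x0"
    unfolding x0_def[abs_def] by (rule locally_dyadic_If) (use loc 3 in auto)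
  moreover have "strict_mono x0" by (rule strict_monoI) (auto simp: x0_def)
  ultimately show ?thesis by (auto simp: thompson_line_def x0_def)
qed

definition thompson_join :: "(real \<Rightarrow> real) \<Rightarrow> (real \<Rightarrow> real) \<Rightarrow> real \<Rightarrow> real" where
  "thompson_join f g = rescale 0 (1/2) f \<circ> rescale (1/2) (1/2) g"

lemma thompson_join_thompson_line [simp, intro]:
  "f \<in> thompson_line \<Longrightarrow> g \<in> thompson_line \<Longrightarrow> thompson_join f g \<in> thompson_line"
  by (auto simp: thompson_join_def)

lemma thompson_join_left:
  assumes "f \<in> thompson_line" "g \<in> thompson_line" "x \<le> 1/2"
  shows "thompson_join f g x = rescale 0 (1/2) f x"
  using rescale_outside[OF assms(2), of "1/2" x "1/2"] assms(3) by (simp add: thompson_join_def)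

lemma thompson_join_right:
  assumes "f \<in> thompson_line" "g \<in> thompson_line" "x \<ge> 1/2"
  shows "thompson_join f g x = rescale (1/2) (1/2) g x"
proof -
  have "rescale (1/2) (1/2) g x \<ge> rescale (1/2) (1/2) g (1/2)"
    using assms by (subst thompson_line_le_iff) auto
  moreover have "rescale (1/2) (1/2) g (1/2) = 1/2"
    using assms(2) by (simp add: rescale_def thompson_line_0)
  ultimately show ?thesis
    using rescale_outside[OF assms(1), of "1/2" "rescale (1/2) (1/2) g x" 0]
    by (simp add: thompson_join_def)
qed

section \<open>Binary trees, subdivisions of an interval and tree pairs\<close>

datatype btree = Leaf | Node btree btree

text \<open>Intervals are pairs of left end point and length, so that rescaling acts on the two
  components separately.\<close>

primrec leaves :: "btree \<Rightarrow> real \<Rightarrow> real \<Rightarrow> (real \<times> real) list" where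
  "leaves Leaf a l = [(a, l)]"
| "leaves (Node S T) a l = leaves S a (l / 2) @ leaves T (a + l / 2) (l / 2)"

lemma leaves_rescale:
  "leaves T (b + m * a) (m * l) = map (\<lambda>(x, y). (b + m * x, m * y)) (leaves T a l)"
proof (induction T arbitrary: a l)
  case (Node S T)
  then show ?case using Node.IH(1)[of a "l / 2"] Node.IH(2)[of "a + l / 2" "l / 2"]
    by (simp add: distrib_left add.assoc)
qed simp

lemma leaves_bounds:
  assumes "l > 0" "(x, y) \<in> set (leaves T a l)"
  shows "y > 0" "a \<le> x" "x + y \<le> a + l"
proof -
  have "y > 0 \<and> a \<le> x \<and> x + y \<le> a + l"
    using assms
  proof (induction T arbitrary: a l)
    case (Node S T)
    then show ?case using Node.IH(1)[of "l / 2" a] Node.IH(2)[of "l / 2" "a + l / 2"] by fastforce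
  qed simp
  then show "y > 0" "a \<le> x" "x + y \<le> a + l" by auto
qed

definition affine_match :: "(real \<Rightarrow> real) \<Rightarrow> real \<times> real \<Rightarrow> real \<times> real \<Rightarrow> bool" where
  "affine_match f = (\<lambda>(a, l) (b, m). 0 < l \<and> 0 < m \<and> (\<forall>x\<in>{a..a + l}. f x = b + m / l * (x - a)))"

abbreviation matches :: "(real \<Rightarrow> real) \<Rightarrow> (real \<times> real) list \<Rightarrow> (real \<times> real) list \<Rightarrow> bool" where
  "matches f \<equiv> list_all2 (affine_match f)"

lemma affine_match_comp:
  assumes "affine_match f p q" "affine_match g q r"
  shows "affine_match (g \<circ> f) p r"
proof -
  obtain a l b m c n where pqr: "p = (a, l)" "q = (b, m)" "r = (c, n)" by (metis surj_pair)
  have lmn: "0 < l" "0 < m" "0 < n" and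
    f: "\<And>x. x \<in> {a..a + l} \<Longrightarrow> f x = b + m / l * (x - a)" and
    g: "\<And>x. x \<in> {b..b + m} \<Longrightarrow> g x = c + n / m * (x - b)"
    using assms by (auto simp: pqr affine_match_def)
  have "(g \<circ> f) x = c + n / l * (x - a)" if x: "x \<in> {a..a + l}" for x
  proof -
    have "m / l * (x - a) \<le> m / l * l" "0 \<le> m / l * (x - a)"
      using lmn x by (intro mult_left_mono; simp)+ (use lmn x in simp)
    then have "m / l * (x - a) \<le> m" "0 \<le> m / l * (x - a)" using lmn by simp_all
    then have "f x \<in> {b..b + m}" using f[OF x] by auto
    then show ?thesis using f[OF x] g lmn by simp
  qed
  then show ?thesis using lmn by (simp add: pqr affine_match_def)
qed

lemma matches_comp: "matches f ps qs \<Longrightarrow> matches g qs rs \<Longrightarrow> matches (g \<circ> f) ps rs"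
  by (rule list_all2_trans[OF affine_match_comp])

lemma matches_leaves_affine:
  assumes "affine_match f (a, l) (b, m)"
  shows "matches f (leaves T a l) (leaves T b m)"
  using assms
proof (induction T arbitrary: a l b m)
  case (Node S T)
  have lm: "0 < l" "0 < m" and f: "\<And>x. x \<in> {a..a + l} \<Longrightarrow> f x = b + m / l * (x - a)"
    using Node.prems by (auto simp: affine_match_def)
  have "affine_match f (a, l / 2) (b, m / 2)" "affine_match f (a + l / 2, l / 2) (b + m / 2, m / 2)"
    using lm by (auto simp: affine_match_def f add_divide_distrib diff_divide_distrib algebra_simps)
  then show ?case using Node.IH by (auto intro!: list_all2_appendI)
qed simp

lemma matches_cong:
  assumes "matches f ps qs" "\<And>a l x. (a, l) \<in> set ps \<Longrightarrow> x \<in> {a..a + l} \<Longrightarrow> f x = g x"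
  shows "matches g ps qs"
proof (rule list.rel_mono_strong[OF assms(1)])
  fix p q assume "p \<in> set ps" "affine_match f p q"
  then show "affine_match g p q"
    using assms(2)[of "fst p" "snd p"] by (auto simp: affine_match_def split_beta)
qed

lemma matches_rescale:
  assumes "matches f ps qs" "c > 0"
  shows "matches (rescale d c f) (map (\<lambda>(x, y). (d + c * x, c * y)) ps) (map (\<lambda>(x, y). (d + c * x, c * y)) qs)"
proof -
  define A :: "real \<times> real \<Rightarrow> real \<times> real" where "A = (\<lambda>(x, y). (d + c * x, c * y))"
  have "affine_match (rescale d c f) (A p) (A q)" if "affine_match f p q" for p q
  proof -
    obtain a l b m where pq: "p = (a, l)" "q = (b, m)" by (metis surj_pair)
    have lm: "0 < l" "0 < m" and f: "\<And>x. x \<in> {a..a + l} \<Longrightarrow> f x = b + m / l * (x - a)"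
      using that by (auto simp: affine_match_def pq)
    have "rescale d c f x = d + c * b + (c * m) / (c * l) * (x - (d + c * a))"
      if "x \<in> {d + c * a..d + c * a + c * l}" for x
    proof -
      define y where "y = (x - d) / c"
      have x: "x = d + c * y" using \<open>c > 0\<close> by (simp add: y_def)
      have "c * a \<le> c * y" "c * y \<le> c * (a + l)" using that by (auto simp: x distrib_left)
      then have "y \<in> {a..a + l}" using \<open>c > 0\<close> by simp
      then have "rescale d c f x = d + c * (b + m / l * (y - a))"
        using f by (simp add: rescale_def flip: y_def)
      also have "\<dots> = d + c * b + (c * m) / (c * l) * (x - (d + c * a))"
        using \<open>c > 0\<close> by (simp add: x algebra_simps diff_divide_distrib)
      finally show ?thesis .
    qed
    then show ?thesis using lm \<open>c > 0\<close> by (auto simp: affine_match_def pq A_def)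
  qed
  then have "matches (rescale d c f) (map A ps) (map A qs)"
    using assms(1) by (auto simp: list.rel_map elim: list.rel_mono_strong)
  then show ?thesis unfolding A_def .
qed

lemma matches_join:
  assumes f: "f \<in> thompson_line" "matches f (leaves S 0 1) (leaves S' 0 1)"
    and g: "g \<in> thompson_line" "matches g (leaves T 0 1) (leaves T' 0 1)"
  shows "matches (thompson_join f g) (leaves (Node S T) 0 1) (leaves (Node S' T') 0 1)"
proof -
  have "matches (rescale 0 (1/2) f) (leaves S 0 (1/2)) (leaves S' 0 (1/2))"
    using matches_rescale[OF f(2), of "1/2" 0] leaves_rescale[of _ 0 "1/2" 0 1] by simp
  then have 1: "matches (thompson_join f g) (leaves S 0 (1/2)) (leaves S' 0 (1/2))"
    by (rule matches_cong) (use leaves_bounds[of "1/2" _ _ S 0] thompson_join_left[OF f(1) g(1)] in force)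
  have "matches (rescale (1/2) (1/2) g) (leaves T (1/2) (1/2)) (leaves T' (1/2) (1/2))"
    using matches_rescale[OF g(2), of "1/2" "1/2"] leaves_rescale[of _ "1/2" "1/2" 0 1] by simp
  then have 2: "matches (thompson_join f g) (leaves T (1/2) (1/2)) (leaves T' (1/2) (1/2))"
    by (rule matches_cong) (use leaves_bounds[of "1/2" _ _ T "1/2"] thompson_join_right[OF f(1) g(1)] in force)
  show ?thesis using 1 2 by (simp add: list_all2_appendI)
qed

text \<open>Rotation at the root: \<open>R\<close>, \<open>S\<close>, \<open>T\<close> subdivide
  intervals of lengths 1/4, 1/4, 1/2 in the source and 1/2, 1/4, 1/4 in the target, and
  \<open>x0\<close> is affine on each of them.\<close>

lemma matches_x0: "matches x0 (leaves (Node (Node R S) T) 0 1) (leaves (Node R (Node S T)) 0 1)"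
proof -
  have "affine_match x0 (0, 1/4) (0, 1/2)" "affine_match x0 (1/4, 1/4) (1/2, 1/4)"
    "affine_match x0 (1/2, 1/2) (3/4, 1/4)"
    by (auto simp: affine_match_def x0_def diff_divide_distrib)
  then show ?thesis by (auto intro!: list_all2_appendI matches_leaves_affine)
qed

text \<open>A tiling without a tree: images of leaves can be seen to tile the unit interval before a
  tree for them is known.\<close>

fun chain :: "real \<Rightarrow> (real \<times> real) list \<Rightarrow> real \<Rightarrow> bool" where
  "chain a [] c \<longleftrightarrow> a = c"
| "chain a ((b, m) # ps) c \<longleftrightarrow> a = b \<and> chain (b + m) ps c"

lemma chain_append: "chain a (ps @ qs) c \<longleftrightarrow> (\<exists>b. chain a ps b \<and> chain b qs c)"
  by (induction ps arbitrary: a) auto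

lemma chain_leaves: "chain a (leaves T a l) (a + l)"
proof (induction T arbitrary: a l)
  case (Node S T)
  then show ?case using Node.IH(1)[of a "l / 2"] Node.IH(2)[of "a + l / 2" "l / 2"]
    by (auto simp: chain_append add.assoc intro!: exI[of _ "a + l / 2"])
qed simp

lemma matches_unique:
  assumes "matches f ps qs" "matches g ps qs" "chain a ps c" "a \<le> x" "x < c"
  shows "f x = g x"
  using assms
proof (induction arbitrary: a rule: list_all2_induct)
  case (Cons p ps q qs)
  obtain b m where p: "p = (b, m)" by fastforce
  show ?case
  proof (cases "x \<le> b + m")
    case True
    then show ?thesis using Cons.hyps Cons.prems by (cases q) (auto simp: p affine_match_def)
  next
    case False
    then show ?thesis using Cons.IH[of "b + m"] Cons.prems by (auto simp: p)
  qed
qed simp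

text \<open>The right comb, serving as normal form among trees with the same number of
  leaves.\<close>

primrec vine :: "nat \<Rightarrow> btree" where
  "vine 0 = Leaf"
| "vine (Suc n) = Node Leaf (vine n)"

primrec nodes :: "btree \<Rightarrow> nat" where
  "nodes Leaf = 0"
| "nodes (Node S T) = Suc (nodes S + nodes T)"

lemma length_leaves: "length (leaves T a l) = Suc (nodes T)"
  by (induction T arbitrary: a l) auto

lemma matches_id: "matches id (leaves T 0 1) (leaves T 0 1)"
  by (rule matches_leaves_affine) (simp add: affine_match_def)

section \<open>Standard dyadic intervals and the tree pair of an element\<close>

definition std_interval :: "real \<times> real \<Rightarrow> bool" where
  "std_interval p \<longleftrightarrow> (\<exists>(j::int) (n::nat). p = (of_int j / 2 ^ n, 1 / 2 ^ n))"

lemma std_interval_pos: "std_interval (a, l) \<Longrightarrow> l > 0"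
  by (auto simp: std_interval_def)

lemma std_interval_halves:
  assumes "std_interval (a, l)"
  shows "std_interval (a, l / 2)" "std_interval (a + l / 2, l / 2)"
proof -
  obtain j n where j: "a = of_int j / 2 ^ n" "l = 1 / 2 ^ n"
    using assms by (auto simp: std_interval_def)
  have "(a, l / 2) = (of_int (2 * j) / 2 ^ Suc n, 1 / 2 ^ Suc n)"
    "(a + l / 2, l / 2) = (of_int (2 * j + 1) / 2 ^ Suc n, 1 / 2 ^ Suc n)"
    by (simp_all add: j field_simps)
  then show "std_interval (a, l / 2)" "std_interval (a + l / 2, l / 2)"
    unfolding std_interval_def by blast+
qed

text \<open>The midpoint has denominator \<open>2 ^ (n + 1)\<close> and is thus a grid point of
  every finer level, while a standard interval contains no grid point of its own level in its
  interior.\<close>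

lemma std_interval_midpoint:
  assumes "std_interval (a, l)" "std_interval (b, m)" "m < l"
  shows "\<not> (b < a + l / 2 \<and> a + l / 2 < b + m)"
proof
  assume *: "b < a + l / 2 \<and> a + l / 2 < b + m"
  obtain j n where j: "a = of_int j / 2 ^ n" "l = 1 / 2 ^ n"
    using assms by (auto simp: std_interval_def)
  obtain i k where i: "b = of_int i / 2 ^ k" "m = 1 / 2 ^ k"
    using assms by (auto simp: std_interval_def)
  have "(2::real) ^ n < 2 ^ k"
    using assms(3) by (simp add: i j field_simps)
  then have "n < k" by simp
  then obtain d where d: "k = Suc (n + d)" using less_imp_Suc_add by blast
  have "a + l / 2 = of_int ((2 * j + 1) * 2 ^ d) / 2 ^ k"
    by (simp add: j d power_add field_simps)
  then have "of_int i < real_of_int ((2 * j + 1) * 2 ^ d)"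
    "real_of_int ((2 * j + 1) * 2 ^ d) < of_int (i + 1)"
    using * by (simp_all add: i field_simps)
  then have "i < (2 * j + 1) * 2 ^ d" "(2 * j + 1) * 2 ^ d < i + 1"
    by (simp_all only: of_int_less_iff)
  then show False by linarith
qed

lemma chain_split:
  assumes "chain a qs c" "a \<le> p" "p \<le> c" "\<And>b m. (b, m) \<in> set qs \<Longrightarrow> \<not> (b < p \<and> p < b + m)"
  shows "\<exists>us vs. qs = us @ vs \<and> chain a us p \<and> chain p vs c"
  using assms
proof (induction qs arbitrary: a)
  case Nil
  then show ?case by auto
next
  case (Cons q qs)
  obtain b m where q: "q = (b, m)" by fastforce
  show ?case
  proof (cases "a = p")
    case True
    then show ?thesis using Cons.prems by (intro exI[of _ "[]"] exI[of _ "q # qs"]) auto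
  next
    case False
    then have "b + m \<le> p" using Cons.prems by (force simp: q)
    then obtain us vs where "qs = us @ vs" "chain (b + m) us p" "chain p vs c"
      using Cons.IH[of "b + m"] Cons.prems by (auto simp: q)
    then show ?thesis using Cons.prems by (intro exI[of _ "q # us"] exI[of _ vs]) (auto simp: q)
  qed
qed

lemma chain_sum: "chain a qs c \<Longrightarrow> c = a + sum_list (map snd qs)"
proof (induction qs arbitrary: a)
  case (Cons q qs)
  obtain b m where q: "q = (b, m)" by fastforce
  then show ?case using Cons.prems Cons.IH[of "b + m"] by (auto simp: add.assoc)
qed simp

text \<open>If there is more than one piece, each piece is shorter than \<open>l\<close>, so none
  straddles the midpoint. The tiling therefore splits there into tilings of the two halves with
  fewer pieces each.\<close>

lemma std_chain_leaves:
  assumes "chain a qs (a + l)" "std_interval (a, l)" "\<And>q. q \<in> set qs \<Longrightarrow> std_interval q"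
  shows "\<exists>T. leaves T a l = qs"
  using assms
proof (induction "length qs" arbitrary: qs a l rule: less_induct)
  case less
  have l: "l > 0" using std_interval_pos less.prems by blast
  have pos: "m > 0" if "(b, m) \<in> set qs" for b m
    using that less.prems(3) std_interval_pos by blast
  obtain b m qs' where qs: "qs = (b, m) # qs'"
    using less.prems(1) l by (cases qs) auto
  show ?case
  proof (cases "qs' = []")
    case True
    then have "qs = [(a, l)]" using less.prems(1) by (auto simp: qs)
    then show ?thesis by (intro exI[of _ Leaf]) simp
  next
    case False
    have small: "y < l" if xy: "(x, y) \<in> set qs" for x y
    proof -
      obtain us vs where uv: "qs = us @ (x, y) # vs" using split_list[OF xy] by blast
      have "l = sum_list (map snd qs)" using chain_sum[OF less.prems(1)] by simp
      then have sum: "l = y + sum_list (map snd (us @ vs))" by (simp add: uv)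
      have "us @ vs \<noteq> []" using False uv by (auto simp: qs)
      moreover have "\<forall>q\<in>set (us @ vs). snd q > 0" using pos unfolding uv by force
      moreover have "ws \<noteq> [] \<Longrightarrow> \<forall>q\<in>set ws. snd q > 0 \<Longrightarrow> sum_list (map snd ws) > 0"
        for ws :: "(real \<times> real) list"
        by (induction ws) (force intro: add_pos_nonneg sum_list_nonneg less_imp_le)+
      ultimately have "sum_list (map snd (us @ vs)) > 0" by blast
      then show ?thesis using sum by simp
    qed
    have "\<exists>us vs. qs = us @ vs \<and> chain a us (a + l / 2) \<and> chain (a + l / 2) vs (a + l)"
      using std_interval_midpoint[OF less.prems(2)] less.prems(3) small l
      by (intro chain_split[OF less.prems(1)]) auto
    then obtain us vs where uv: "qs = us @ vs" "chain a us (a + l / 2)" "chain (a + l / 2) vs (a + l / 2 + l / 2)"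
      by (auto simp: add.assoc)
    then have "us \<noteq> []" "vs \<noteq> []" using l by auto
    then have len: "length us < length qs" "length vs < length qs" by (auto simp: uv)
    obtain S where "leaves S a (l / 2) = us"
      using less.hyps[OF len(1) uv(2)] std_interval_halves[OF less.prems(2)] less.prems(3) uv(1) by auto
    moreover obtain T where "leaves T (a + l / 2) (l / 2) = vs"
      using less.hyps[OF len(2) uv(3)] std_interval_halves[OF less.prems(2)] less.prems(3) uv(1) by auto
    ultimately have "leaves (Node S T) a l = qs" by (simp add: uv)
    then show ?thesis by blast
  qed
qed

primrec full_tree :: "nat \<Rightarrow> btree" where
  "full_tree 0 = Leaf"
| "full_tree (Suc n) = Node (full_tree n) (full_tree n)"

lemma leaves_full_tree:
  assumes "p \<in> set (leaves (full_tree n) (of_int j / 2 ^ k) (1 / 2 ^ k))"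
  shows "\<exists>i::int. p = (of_int i / 2 ^ (k + n), 1 / 2 ^ (k + n))"
  using assms
proof (induction n arbitrary: j k)
  case (Suc n)
  have "of_int j / 2 ^ k = of_int (2 * j) / (2 ^ Suc k :: real)"
    "of_int j / 2 ^ k + 1 / 2 ^ k / 2 = of_int (2 * j + 1) / (2 ^ Suc k :: real)"
    "1 / 2 ^ k / 2 = 1 / (2 ^ Suc k :: real)"
    by (simp_all add: field_simps)
  then have "p \<in> set (leaves (full_tree n) (of_int (2 * j) / 2 ^ Suc k) (1 / 2 ^ Suc k)) \<or>
      p \<in> set (leaves (full_tree n) (of_int (2 * j + 1) / 2 ^ Suc k) (1 / 2 ^ Suc k))"
    using Suc.prems by (metis Un_iff full_tree.simps(2) leaves.simps(2) set_append)
  then have "\<exists>i::int. p = (of_int i / 2 ^ (Suc k + n), 1 / 2 ^ (Suc k + n))"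
    using Suc.IH[of "2 * j" "Suc k"] Suc.IH[of "2 * j + 1" "Suc k"] by blast
  then show ?case by simp
qed auto

definition std_image :: "(real \<Rightarrow> real) \<Rightarrow> int \<Rightarrow> nat \<Rightarrow> bool" where
  "std_image f j n \<longleftrightarrow> (\<exists>q. std_interval q \<and> affine_match f (of_int j / 2 ^ n, 1 / 2 ^ n) q)"

text \<open>The map \<open>2 powi k * x + c / 2 ^ r\<close> sends the grid of level \<open>n\<close>
  to the grid of level \<open>n - k\<close> shifted by the constant. The shift preserves that grid
  once \<open>n - k \<ge> r\<close>, which \<open>n \<ge> r + nat k\<close> ensures for either sign
  of \<open>k\<close>.\<close>

lemma dyadic_affine_std_image:
  assumes "dyadic_affine_on A f"
  shows "\<exists>N. \<forall>n\<ge>N. \<forall>j::int. {of_int j / 2 ^ n..of_int (j + 1) / 2 ^ n} \<subseteq> A \<longrightarrow> std_image f j n"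
proof -
  obtain k d where d: "d \<in> dyadic_rationals" and f: "\<And>x. x \<in> A \<Longrightarrow> f x = 2 powi k * x + d"
    using assms by (auto simp: dyadic_affine_on_def dyadic_affine_def)
  obtain c r where c: "d = of_int c / 2 ^ r" using d by (auto simp: dyadic_rationals_def)
  have "std_image f j n" if n: "n \<ge> r + nat k" and A: "{of_int j / 2 ^ n..of_int (j + 1) / 2 ^ n} \<subseteq> A" for n j
  proof -
    define p where "p = nat (int n - k)"
    have p: "int p = int n - k" "r \<le> p" using n by (auto simp: p_def)
    have pow: "2 powi k = (2::real) ^ n / 2 ^ p"
    proof -
      have "2 powi k = (2::real) powi (int n - int p)" using p(1) by simp
      then show ?thesis by (simp add: power_int_diff)
    qed
    obtain q where q: "p = r + q" using p(2) le_Suc_ex by blast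
    let ?b = "of_int (j + c * 2 ^ q) / 2 ^ p" and ?m = "1 / 2 ^ p :: real"
    have db: "of_int j / 2 ^ p + d = ?b" by (simp add: c q power_add add_divide_distrib)
    have "f x = ?b + ?m / (1 / 2 ^ n) * (x - of_int j / 2 ^ n)"
      if "x \<in> {of_int j / 2 ^ n..of_int j / 2 ^ n + 1 / 2 ^ n}" for x
    proof -
      have "x \<in> A" using that A by (auto simp: add_divide_distrib)
      then have "f x = 2 ^ n / 2 ^ p * x + d" using f pow by simp
      also have "\<dots> = ?b + ?m / (1 / 2 ^ n) * (x - of_int j / 2 ^ n)"
        unfolding db[symmetric] by (simp add: field_simps)
      finally show ?thesis .
    qed
    then have "affine_match f (of_int j / 2 ^ n, 1 / 2 ^ n) (?b, ?m)"
      by (simp add: affine_match_def)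
    moreover have "std_interval (?b, ?m)" unfolding std_interval_def by blast
    ultimately show ?thesis unfolding std_image_def by blast
  qed
  then show ?thesis by blast
qed

text \<open>
  Quantifying over all standard intervals that meet \<open>[u, v]\<close> makes the property additive in \<open>[u, v]\<close> even
  if the common end point is not dyadic.
\<close>

lemma locally_dyadic_std_image:
  assumes f: "locally_dyadic f"
  obtains N where "\<And>j::int. of_int j / 2 ^ N \<in> {0..1::real} \<Longrightarrow> std_image f j N"
proof -
  define meet where "meet n j u v \<longleftrightarrow> {of_int j / 2 ^ n..of_int (j + 1) / 2 ^ n} \<inter> {u..v} \<noteq> {}"
    for n :: nat and j :: int and u v :: real
  have "\<exists>N. \<forall>n\<ge>N. \<forall>j. meet n j 0 1 \<longrightarrow> std_image f j n"
    using zero_le_one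
  proof (induction rule: Bolzano)
    case (trans a b c)
    then obtain N N' where N: "\<forall>n\<ge>N. \<forall>j. meet n j a b \<longrightarrow> std_image f j n"
      "\<forall>n\<ge>N'. \<forall>j. meet n j b c \<longrightarrow> std_image f j n" by blast
    have "meet n j a b \<or> meet n j b c" if "meet n j a c" for n j
      using that trans(3,4) by (auto simp: meet_def)
    then show ?case using N by (intro exI[of _ "max N N'"]) (meson max.bounded_iff)
  next
    case (local x)
    obtain e where e: "e > 0" "dyadic_affine_on {x..x + e} f" "dyadic_affine_on {x - e..x} f"
      "x \<notin> dyadic_rationals \<Longrightarrow> dyadic_affine_on {x - e..x + e} f"
      using locally_dyadic_uniform_radius[OF f] by metis
    \<comment> \<open>One half of \<open>e\<close> is reserved for the length of
      \<open>[u, v]\<close>, the other for the standard interval that meets it.\<close>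
    obtain N1 where N1: "1 / 2 ^ N1 < e / 2"
      using real_arch_pow_inv[of "e / 2" "1 / 2"] e(1) by (auto simp: power_one_over)
    have near: "{of_int j / 2 ^ n..of_int (j + 1) / 2 ^ n} \<subseteq> {x - e..x + e}"
      if mt: "meet n j u v" and "n \<ge> N1" "u \<le> x \<and> x \<le> v \<and> v - u < e / 2" for n j u v
    proof -
      have "(1::real) / 2 ^ n \<le> 1 / 2 ^ N1"
        using that(2) by (simp add: frac_le)
      moreover have "of_int (j + 1) / 2 ^ n = of_int j / 2 ^ n + (1::real) / 2 ^ n"
        by (simp add: add_divide_distrib)
      moreover obtain z where "z \<in> {of_int j / 2 ^ n..of_int (j + 1) / 2 ^ n}" "z \<in> {u..v}"
        using mt unfolding meet_def by blast
      ultimately show ?thesis using that(3) N1 unfolding atLeastatMost_subset_iff atLeastAtMost_iff by linarith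
    qed
    have "\<exists>N. \<forall>n\<ge>N. \<forall>j::int. {of_int j / 2 ^ n..of_int (j + 1) / 2 ^ n} \<subseteq> {x - e..x + e} \<longrightarrow> std_image f j n"
    proof (cases "x \<in> dyadic_rationals")
      case False
      then show ?thesis using dyadic_affine_std_image e(4) by blast
    next
      case True
      then obtain c r where x: "x = of_int c / 2 ^ r" by (auto simp: dyadic_rationals_def)
      obtain N2 where N2: "\<forall>n\<ge>N2. \<forall>j::int. {of_int j / 2 ^ n..of_int (j + 1) / 2 ^ n} \<subseteq> {x..x + e} \<longrightarrow> std_image f j n"
        using dyadic_affine_std_image[OF e(2)] by blast
      obtain N3 where N3: "\<forall>n\<ge>N3. \<forall>j::int. {of_int j / 2 ^ n..of_int (j + 1) / 2 ^ n} \<subseteq> {x - e..x} \<longrightarrow> std_image f j n"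
        using dyadic_affine_std_image[OF e(3)] by blast
      have "std_image f j n" if n: "n \<ge> max r (max N2 N3)"
        and j: "{of_int j / 2 ^ n..of_int (j + 1) / 2 ^ n} \<subseteq> {x - e..x + e}" for n j
      proof -
        \<comment> \<open>From level \<open>r\<close> on, the dyadic point \<open>x\<close> is a
          grid point, so every standard interval lies on one side of it and a one-sided germ is
          enough.\<close>
        define i where "i = c * 2 ^ (n - r)"
        have "(2::real) ^ n = 2 ^ (n - r) * 2 ^ r" using n by (simp flip: power_add)
        then have xi: "x = of_int i / 2 ^ n" by (simp add: x i_def)
        have bounds: "x - e \<le> of_int j / 2 ^ n" "of_int (j + 1) / 2 ^ n \<le> x + e"
          using j by (simp_all add: divide_right_mono)
        show ?thesis
        proof (cases "i \<le> j")
          case True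
          then have "x \<le> of_int j / 2 ^ n" by (simp add: xi divide_right_mono)
          then show ?thesis using N2 n bounds by auto
        next
          case False
          then have "j + 1 \<le> i" by simp
          then have "of_int (j + 1) / 2 ^ n \<le> x" unfolding xi by (intro divide_right_mono) (simp_all only: of_int_le_iff, simp)
          then show ?thesis using N3 n bounds by auto
        qed
      qed
      then show ?thesis by blast
    qed
    then obtain N where "\<forall>n\<ge>N. \<forall>j::int. {of_int j / 2 ^ n..of_int (j + 1) / 2 ^ n} \<subseteq> {x - e..x + e} \<longrightarrow> std_image f j n"
      by blast
    then have "\<exists>N. \<forall>n\<ge>N. \<forall>j. meet n j u v \<longrightarrow> std_image f j n" if "u \<le> x \<and> x \<le> v \<and> v - u < e / 2" for u v
      using near that by (intro exI[of _ "max N N1"]) auto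
    then show ?case using e(1) by (intro exI[of _ "e / 2"]) auto
  qed
  then obtain N where "\<forall>j. meet N j 0 1 \<longrightarrow> std_image f j N" by blast
  moreover have "meet N j 0 1" if "of_int j / 2 ^ N \<in> {0..1::real}" for j
    using that by (auto simp: meet_def divide_right_mono)
  ultimately show thesis using that by blast
qed

text \<open>At a fine enough level, \<open>f\<close> maps every leaf interval of the full tree
  affinely onto a standard interval. The images tile the unit interval in order, so they are the
  leaves of a tree as well.\<close>

lemma thompson_line_tree_pair:
  assumes f: "f \<in> thompson_line"
  obtains S T where "matches f (leaves S 0 1) (leaves T 0 1)"
proof -
  have "locally_dyadic f" using f by (simp add: thompson_line_def)
  then obtain N where N: "\<And>j::int. of_int j / 2 ^ N \<in> {0..1::real} \<Longrightarrow> std_image f j N"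
    using locally_dyadic_std_image by blast
  define ps where "ps = leaves (full_tree N) 0 1"
  have "\<exists>q. std_interval q \<and> affine_match f p q" if p: "p \<in> set ps" for p
  proof -
    obtain i :: int where i: "p = (of_int i / 2 ^ N, 1 / 2 ^ N)"
      using leaves_full_tree[of p N 0 0] p by (auto simp: ps_def)
    have "of_int i / 2 ^ N \<in> {0..1::real}"
      using leaves_bounds[of 1 "of_int i / 2 ^ N" "1 / 2 ^ N" "full_tree N" 0] p
      by (auto simp: i ps_def intro: order_trans[of _ "of_int i / 2 ^ N + 1 / 2 ^ N"] simp del: divide_le_eq_1_pos)
    then show ?thesis using N unfolding i std_image_def by blast
  qed
  then obtain F where F: "\<And>p. p \<in> set ps \<Longrightarrow> std_interval (F p) \<and> affine_match f p (F p)"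
    by metis
  have Fp: "F (b, m) = (f b, f (b + m) - f b)" if "(b, m) \<in> set ps" for b m
    using F[OF that] by (cases "F (b, m)") (auto simp: affine_match_def)
  have "chain (f a) (map F ps') (f c)" if "chain a ps' c" "set ps' \<subseteq> set ps" for a c ps'
    using that
  proof (induction ps' arbitrary: a)
    case (Cons p ps')
    then show ?case using Fp by (cases p) auto
  qed simp
  moreover have "chain 0 ps 1" using chain_leaves[of 0 "full_tree N" 1] by (simp add: ps_def)
  ultimately have "chain (f 0) (map F ps) (f 1)" by blast
  then have "chain 0 (map F ps) (0 + 1)" using f by (simp add: thompson_line_0 thompson_line_1)
  moreover have "std_interval (0, 1)"
    unfolding std_interval_def by (intro exI[of _ 0] exI[of _ 0]) simp
  ultimately obtain T where T: "leaves T 0 1 = map F ps"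
    using std_chain_leaves[of 0 "map F ps" 1] F by (metis (no_types, lifting) imageE set_map)
  have "matches f ps (map F ps)"
    using F by (auto simp: list_all2_conv_all_nth)
  then show thesis using that T by (metis ps_def)
qed

text \<open>
  The elements satisfying \<open>P\<close> connect every tree to the vine with the same number of leaves, by rotations
  at the root and recursion into the two halves.
\<close>

theorem thompson_line_induct [consumes 1, case_names id x0 inv comp join]:
  assumes f: "f \<in> thompson_line"
    and id: "P id" and x0: "P x0"
    and inv: "\<And>f. f \<in> thompson_line \<Longrightarrow> P f \<Longrightarrow> P (finv f)"
    and comp: "\<And>f g. f \<in> thompson_line \<Longrightarrow> g \<in> thompson_line \<Longrightarrow> P f \<Longrightarrow> P g \<Longrightarrow> P (f \<circ> g)"
    and join: "\<And>f g. f \<in> thompson_line \<Longrightarrow> g \<in> thompson_line \<Longrightarrow> P f \<Longrightarrow> P g \<Longrightarrow> P (thompson_join f g)"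
  shows "P f"
proof -
  define E where "E = {f \<in> thompson_line. P f}"
  have vines: "\<exists>f\<in>E. matches f (leaves (Node (vine m) (vine n)) 0 1) (leaves (vine (Suc (m + n))) 0 1)" for m n
  proof (induction m)
    case 0
    have "id \<in> E" using id by (simp add: E_def)
    then show ?case using matches_id[of "vine (Suc n)"] by (intro bexI[of _ id]) (simp_all add: id_def)
  next
    case (Suc m)
    then obtain f where f: "f \<in> E" "matches f (leaves (Node (vine m) (vine n)) 0 1) (leaves (vine (Suc (m + n))) 0 1)"
      by blast
    \<comment> \<open>The rotation \<open>x0\<close> moves all but the first leaf of the left vine
      over to the right half, where the induction hypothesis finishes.\<close>
    have "matches (thompson_join id f) (leaves (Node Leaf (Node (vine m) (vine n))) 0 1)
        (leaves (Node Leaf (vine (Suc (m + n)))) 0 1)"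
      using f by (intro matches_join matches_id) (auto simp: E_def)
    with matches_x0 have "matches (thompson_join id f \<circ> x0) (leaves (Node (Node Leaf (vine m)) (vine n)) 0 1)
        (leaves (Node Leaf (vine (Suc (m + n)))) 0 1)"
      by (rule matches_comp)
    moreover have "thompson_join id f \<circ> x0 \<in> E"
      using f(1) id x0 comp join by (auto simp: E_def)
    ultimately show ?case unfolding vine.simps add_Suc by blast
  qed
  have canonical: "\<exists>f\<in>E. matches f (leaves T 0 1) (leaves (vine (nodes T)) 0 1)" for T
  proof (induction T)
    case Leaf
    have "id \<in> E" using id by (simp add: E_def)
    then show ?case using matches_id[of Leaf] by (intro bexI[of _ id]) (simp_all add: id_def)
  next
    case (Node S T)
    then obtain f g where f: "f \<in> E" "matches f (leaves S 0 1) (leaves (vine (nodes S)) 0 1)"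
      and g: "g \<in> E" "matches g (leaves T 0 1) (leaves (vine (nodes T)) 0 1)" by blast
    obtain h where h: "h \<in> E" "matches h (leaves (Node (vine (nodes S)) (vine (nodes T))) 0 1)
        (leaves (vine (Suc (nodes S + nodes T))) 0 1)"
      using vines by blast
    have "matches (thompson_join f g) (leaves (Node S T) 0 1) (leaves (Node (vine (nodes S)) (vine (nodes T))) 0 1)"
      using f g by (intro matches_join) (auto simp: E_def)
    then have "matches (h \<circ> thompson_join f g) (leaves (Node S T) 0 1) (leaves (vine (Suc (nodes S + nodes T))) 0 1)"
      using h(2) by (rule matches_comp)
    moreover have "h \<circ> thompson_join f g \<in> E"
      using f(1) g(1) h(1) comp join by (auto simp: E_def)
    ultimately show ?case unfolding nodes.simps by blast
  qed
  obtain S T where ST: "matches f (leaves S 0 1) (leaves T 0 1)"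
    using thompson_line_tree_pair[OF f] .
  \<comment> \<open>Both trees of the pair have the same number of leaves and hence the same vine;
    passing through it writes \<open>f\<close> as \<open>finv h \<circ> g\<close>.\<close>
  then have "nodes S = nodes T"
    using list_all2_lengthD[OF ST] by (simp add: length_leaves)
  then obtain g h where g: "g \<in> E" "matches g (leaves S 0 1) (leaves (vine (nodes T)) 0 1)"
    and h: "h \<in> E" "matches h (leaves T 0 1) (leaves (vine (nodes T)) 0 1)"
    using canonical[of S] canonical[of T] by auto
  have E: "g \<in> thompson_line" "h \<in> thompson_line" using g h by (auto simp: E_def)
  have "(h \<circ> f) x = g x" for x
  proof (cases "x \<in> {0<..<1}")
    case True
    then show ?thesis
      using matches_unique[OF matches_comp[OF ST h(2)] g(2)] chain_leaves[of 0 S 1] by simp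
  next
    case False
    then show ?thesis
      using thompson_line_outside[OF f False] thompson_line_outside[OF E(1) False]
        thompson_line_outside[OF E(2) False] by simp
  qed
  then have "f x = (finv h \<circ> g) x" for x
    using inv_thompson_line_apply(1)[OF E(2), of "f x"] by (metis comp_apply)
  then have "f = finv h \<circ> g" by blast
  then show ?thesis using E g h inv comp by (auto simp: E_def)
qed

section \<open>Normal subgroups contain all elements that are trivial near the end points\<close>

text \<open>Inside the interval \<open>u\<close> is the affine change of coordinates between the two
  copies; outside, both copies are the identity, so the behaviour of \<open>u\<close> there does not
  matter.\<close>

lemma rescale_conj:
  assumes f: "f \<in> thompson_line" and u: "u \<in> thompson_line" and match: "affine_match u (a, l) (b, m)"
  shows "u \<circ> rescale a l f \<circ> finv u = rescale b m f"
proof -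
  have lm: "0 < l" "0 < m" and ux: "\<And>x. x \<in> {a..a + l} \<Longrightarrow> u x = b + m / l * (x - a)"
    using match by (auto simp: affine_match_def)
  have ends: "u a = b" "u (a + l) = b + m" using ux[of a] ux[of "a + l"] lm by auto
  have ux': "u (a + l * y) = b + m * y" if "y \<in> {0..1}" for y
    using ux[of "a + l * y"] that lm by (auto simp: mult_le_cancel_left1)
  have "u (rescale a l f x) = rescale b m f (u x)" for x
  proof (cases "x \<in> {a<..<a + l}")
    case True
    define y where "y = (x - a) / l"
    have x: "x = a + l * y" using lm by (simp add: y_def)
    have y: "y \<in> {0..1}" using True lm by (auto simp: y_def field_simps)
    then have "f y \<in> {0..1}" using thompson_line_Icc[OF f] by blast
    then show ?thesis using y lm by (simp add: x rescale_apply ux')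
  next
    case False
    then have "x \<le> a \<or> a + l \<le> x" by auto
    then have "u x \<le> b \<or> b + m \<le> u x"
      using thompson_line_le_iff[OF u, of x a] thompson_line_le_iff[OF u, of "a + l" x] by (auto simp: ends)
    then have "rescale b m f (u x) = u x" using lm by (intro rescale_outside[OF f]) auto
    moreover have "rescale a l f x = x" using False lm by (intro rescale_outside[OF f]) auto
    ultimately show ?thesis by simp
  qed
  then show ?thesis using u by (simp add: fun_eq_iff)
qed

lemma x0_right: "rescale (1/2) (1/2) x0 x =
  (if x \<le> 1/2 then x else if x \<le> 5/8 then 2 * x - 1/2 else if x \<le> 3/4 then x + 1/8
   else if x \<le> 1 then (x + 1) / 2 else x)"
  by (auto simp: rescale_def x0_def field_simps)

lemma x0_left: "rescale 0 (1/2) x0 x =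
  (if x \<le> 0 then x else if x \<le> 1/8 then 2 * x else if x \<le> 1/4 then x + 1/8
   else if x \<le> 1/2 then (x + 1/2) / 2 else x)"
  by (auto simp: rescale_def x0_def field_simps)

text \<open>The two ways of rotating a left comb with four leaves into a right comb.\<close>

lemma pentagon: "rescale (1/2) (1/2) x0 \<circ> x0 \<circ> rescale 0 (1/2) x0 = x0 \<circ> x0"
proof
  fix x :: real
  consider "x \<le> 0" | "0 < x" "x \<le> 1/8" | "1/8 < x" "x \<le> 1/4" | "1/4 < x" "x \<le> 1/2" | "1/2 < x" "x \<le> 1" | "x > 1"
    by linarith
  then show "(rescale (1/2) (1/2) x0 \<circ> x0 \<circ> rescale 0 (1/2) x0) x = (x0 \<circ> x0) x"
    by cases (auto simp: x0_right x0_left x0_def field_simps)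
qed

text \<open>Each step doubles the interval. The left half of \<open>[1/2, 3/4]\<close> is stretched
  onto the whole by the copy of \<open>x0\<close> on the right half of the unit interval, and the
  right half by that copy followed by \<open>finv x0\<close>.\<close>

lemma std_subinterval_to_base:
  assumes "0 \<le> j" "j < 2 ^ n"
  shows "\<exists>u\<in>thompson_line. affine_match u (1/2 + of_int j / 2 ^ n / 4, 1 / 2 ^ n / 4) (1/2, 1/4)"
  using assms
proof (induction n arbitrary: j)
  case 0
  then have "j = 0" by simp
  then show ?case by (intro bexI[of _ id]) (auto simp: affine_match_def diff_divide_distrib)
next
  case (Suc n)
  let ?x1 = "rescale (1/2) (1/2) x0"
  define E :: real where "E = 1 / 2 ^ n"
  have E: "E > 0" "1 / 2 ^ n = E" "1 / 2 ^ Suc n = E / 2" by (simp_all add: E_def)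
  have half: "of_int j / 2 ^ Suc n = of_int j / 2 ^ n / (2::real)" by simp
  have "\<exists>v\<in>thompson_line. \<exists>i. 0 \<le> i \<and> i < 2 ^ n \<and>
      affine_match v (1/2 + of_int j / 2 ^ Suc n / 4, 1 / 2 ^ Suc n / 4) (1/2 + of_int i / 2 ^ n / 4, 1 / 2 ^ n / 4)"
  proof (cases "j < 2 ^ n")
    case True
    have "real_of_int (j + 1) \<le> real_of_int (2 ^ n)" using True by (simp only: of_int_le_iff)
    then have *: "real_of_int j / 2 ^ n + E \<le> 1" "0 \<le> real_of_int j / 2 ^ n"
      using Suc.prems by (simp_all add: E_def field_simps)
    have "?x1 y = 2 * y - 1/2" if "1/2 \<le> y" "y \<le> 5/8" for y
      using that by (auto simp: x0_right)
    then have "affine_match ?x1 (1/2 + of_int j / 2 ^ Suc n / 4, 1 / 2 ^ Suc n / 4)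
        (1/2 + of_int j / 2 ^ n / 4, 1 / 2 ^ n / 4)"
      using * E(1) unfolding E half by (auto simp: affine_match_def)
    then show ?thesis using Suc.prems True by (intro bexI[of _ ?x1] exI[of _ j] conjI) auto
  next
    case False
    define i where "i = j - 2 ^ n"
    define J where "J = real_of_int i / 2 ^ n"
    have i: "0 \<le> i" "i < 2 ^ n" using False Suc.prems by (auto simp: i_def)
    have "real_of_int (i + 1) \<le> real_of_int (2 ^ n)" using i by (simp only: of_int_le_iff)
    then have *: "real_of_int i / 2 ^ n + E \<le> 1" "0 \<le> real_of_int i / 2 ^ n"
      using i by (simp_all add: E_def field_simps)
    have j: "real_of_int j / 2 ^ n = 1 + of_int i / 2 ^ n"
      by (simp add: i_def field_simps)
    have shift: "(finv x0 \<circ> ?x1) y = 2 * y - 3/4" if "5/8 \<le> y" "y \<le> 3/4" for y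
    proof -
      have "?x1 y = y + 1/8" using that by (auto simp: x0_right)
      moreover have "x0 (2 * y - 3/4) = y + 1/8" using that by (auto simp: x0_def field_simps)
      ultimately show ?thesis using inv_thompson_line_apply(1)[OF x0_thompson_line, of "2 * y - 3/4"] by simp
    qed
    have "affine_match (finv x0 \<circ> ?x1) (1/2 + of_int j / 2 ^ Suc n / 4, 1 / 2 ^ Suc n / 4)
        (1/2 + of_int i / 2 ^ n / 4, 1 / 2 ^ n / 4)"
      unfolding E half j J_def[symmetric] affine_match_def prod.case
    proof (intro conjI ballI)
      fix x assume "x \<in> {1/2 + (1 + J) / 2 / 4..1/2 + (1 + J) / 2 / 4 + E / 2 / 4}"
      then have x: "5 + J \<le> 8 * x" "8 * x \<le> 5 + J + E" by (auto simp: add_divide_distrib)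
      have "5/8 \<le> x" "x \<le> 3/4" using x * unfolding J_def[symmetric] by auto
      then have "(finv x0 \<circ> ?x1) x = 2 * x - 3/4" by (rule shift)
      also have "\<dots> = 1/2 + J / 4 + E / 4 / (E / 2 / 4) * (x - (1/2 + (1 + J) / 2 / 4))"
        using E(1) by (simp add: field_simps)
      finally show "(finv x0 \<circ> ?x1) x = 1/2 + J / 4 + E / 4 / (E / 2 / 4) * (x - (1/2 + (1 + J) / 2 / 4))" .
    qed (use E(1) in auto)
    moreover have "finv x0 \<circ> ?x1 \<in> thompson_line" by auto
    ultimately show ?thesis using i by blast
  qed
  then obtain v i where v: "v \<in> thompson_line" "0 \<le> i" "i < 2 ^ n"
    "affine_match v (1/2 + of_int j / 2 ^ Suc n / 4, 1 / 2 ^ Suc n / 4) (1/2 + of_int i / 2 ^ n / 4, 1 / 2 ^ n / 4)"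
    by blast
  then obtain u where "u \<in> thompson_line" "affine_match u (1/2 + of_int i / 2 ^ n / 4, 1 / 2 ^ n / 4) (1/2, 1/4)"
    using Suc.IH by blast
  then show ?case using v affine_match_comp thompson_line_comp by blast
qed

lemma funpow_thompson_line [simp, intro]: "f \<in> thompson_line \<Longrightarrow> f ^^ n \<in> thompson_line"
  by (induction n) (auto simp: id_def[symmetric])

text \<open>Doubling leads from \<open>1 / 2 ^ Suc k\<close> to 1/2 in \<open>k\<close> steps, and
  then each step halves the distance to 1. Monotonicity compares the orbit of \<open>e\<close> with
  this explicit one.\<close>

lemma x0_iterate_exceeds:
  assumes "0 < e" "x < 1"
  obtains n where "(x0 ^^ n) e > x"
proof -
  obtain k where k: "1 / 2 ^ k < e"
    using real_arch_pow_inv[of e "1 / 2"] assms(1) by (auto simp: power_one_over)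
  obtain m where m: "1 / 2 ^ m < 1 - x"
    using real_arch_pow_inv[of "1 - x" "1 / 2"] assms(2) by (auto simp: power_one_over)
  have 1: "(x0 ^^ k) (1 / 2 ^ Suc k) = 1/2" for k
  proof (induction k)
    case (Suc k)
    have "(1::real) \<le> 2 ^ k" by simp
    then have "(1::real) / 2 ^ Suc (Suc k) \<le> 1 / 4" by (simp add: field_simps)
    then have "x0 (1 / 2 ^ Suc (Suc k)) = 1 / 2 ^ Suc k" by (auto simp: x0_def power_le_zero_eq)
    then show ?case using Suc by (simp add: funpow_swap1 del: power_Suc)
  qed simp
  have near1: "x0 (1 - t) = 1 - t / 2" if "0 < t" "t \<le> 1/2" for t
    using that by (auto simp: x0_def)
  have 2: "(x0 ^^ m) (1/2) = 1 - 1 / 2 ^ Suc m" for m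
  proof (induction m)
    case (Suc m)
    have "(1::real) \<le> 2 ^ m" by simp
    then have "(1::real) / 2 ^ Suc m \<le> 1 / 2" by (simp add: field_simps)
    then have "x0 (1 - 1 / 2 ^ Suc m) = 1 - 1 / 2 ^ Suc (Suc m)"
      using near1[of "1 / 2 ^ Suc m"] by simp
    then show ?case using Suc by simp
  qed simp
  have "(1::real) / 2 ^ Suc k < 1 / 2 ^ k" "(1::real) / 2 ^ Suc m < 1 / 2 ^ m" by (simp_all add: field_simps)
  have "x < 1 - 1 / 2 ^ Suc m" using m \<open>1 / 2 ^ Suc m < 1 / 2 ^ m\<close> by linarith
  also have "\<dots> = (x0 ^^ (m + k)) (1 / 2 ^ Suc k)" by (simp add: funpow_add 1 2 del: power_Suc)
  also have "\<dots> < (x0 ^^ (m + k)) e"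
    using k \<open>1 / 2 ^ Suc k < 1 / 2 ^ k\<close> by (subst thompson_line_less_iff) auto
  finally show thesis by (rule that)
qed

text \<open>A power of \<open>x0\<close> pushes \<open>e\<close> beyond 1/2. Then an inverse power
  of the copy of \<open>x0\<close> on \<open>[1/2, 1]\<close>, which fixes 1/2, pulls the image of
  \<open>1 - e\<close> down to 3/4.\<close>

lemma squeeze_into_base:
  assumes "0 < e"
  obtains u where "u \<in> thompson_line" "u e \<ge> 1/2" "u (1 - e) \<le> 3/4"
proof -
  obtain n where n: "(x0 ^^ n) e > 1/2" using x0_iterate_exceeds[OF assms, of "1/2"] by auto
  define c where "c = (x0 ^^ n) (1 - e)"
  have "c < (x0 ^^ n) 1" unfolding c_def using assms by (subst thompson_line_less_iff) auto
  then have "c < 1" by (simp add: thompson_line_1)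
  \<comment> \<open>\<open>2 * c - 1\<close> is the position of \<open>c\<close> within the right
    half, and 1/2 is the position of 3/4.\<close>
  then obtain m where m: "(x0 ^^ m) (1/2) > 2 * c - 1" using x0_iterate_exceeds[of "1/2" "2 * c - 1"] by auto
  define v where "v = rescale (1/2) (1/2) (finv (x0 ^^ m))"
  have v: "v \<in> thompson_line" unfolding v_def by (rule rescale_thompson_line) auto
  have x0m: "x0 ^^ m \<in> thompson_line" by auto
  have "finv (x0 ^^ m) (2 * c - 1) < finv (x0 ^^ m) ((x0 ^^ m) (1/2))"
    using m thompson_line_less_iff[OF thompson_line_inv[OF x0m]] by blast
  then have "finv (x0 ^^ m) (2 * c - 1) < 1/2" using x0m by simp
  then have "v c \<le> 3/4" by (simp add: v_def rescale_def algebra_simps)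
  moreover have "v (1/2) = 1/2" using x0m by (simp add: v_def rescale_def thompson_line_0)
  then have "v ((x0 ^^ n) e) \<ge> 1/2" using n thompson_line_le_iff[OF v, of "1/2" "(x0 ^^ n) e"] by simp
  ultimately show thesis
    using v by (intro that[of "v \<circ> x0 ^^ n"]) (auto simp: c_def)
qed

lemma commute_disjoint_support:
  assumes "inj f" "inj g" "A \<inter> B = {}"
    and f: "\<And>x. x \<notin> A \<Longrightarrow> f x = x" and g: "\<And>x. x \<notin> B \<Longrightarrow> g x = x"
  shows "f \<circ> g = g \<circ> f"
proof
  fix x
  have fA: "f x \<in> A" if "x \<in> A" for x using f[of "f x"] that injD[OF assms(1)] by metis
  have gB: "g x \<in> B" if "x \<in> B" for x using g[of "g x"] that injD[OF assms(2)] by metis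
  consider "x \<in> A" "x \<notin> B" | "x \<in> B" "x \<notin> A" | "x \<notin> A" "x \<notin> B" using assms(3) by blast
  then show "(f \<circ> g) x = (g \<circ> f) x"
  proof cases
    case 1
    then have "f x \<notin> B" using fA assms(3) by blast
    then show ?thesis using 1 g by simp
  next
    case 2
    then have "g x \<notin> A" using gB assms(3) by blast
    then show ?thesis using 2 f by simp
  next
    case 3
    then show ?thesis using f g by simp
  qed
qed

section \<open>Normal subgroups and double commutators\<close>

lemma normal_thompson_lineD:
  assumes "N \<lhd> thompson_line_group"
  shows "N \<subseteq> thompson_line" "id \<in> N" "\<And>f g. f \<in> N \<Longrightarrow> g \<in> N \<Longrightarrow> f \<circ> g \<in> N"
    "\<And>f. f \<in> N \<Longrightarrow> finv f \<in> N" "\<And>f g. g \<in> thompson_line \<Longrightarrow> f \<in> N \<Longrightarrow> g \<circ> f \<circ> finv g \<in> N"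
proof -
  interpret N: normal N thompson_line_group by (rule assms)
  show 1: "N \<subseteq> thompson_line" using N.subset by simp
  show "id \<in> N" using N.one_closed by simp
  show "f \<circ> g \<in> N" if "f \<in> N" "g \<in> N" for f g using N.m_closed[OF that] by simp
  show "finv f \<in> N" if "f \<in> N" for f
    using N.m_inv_closed[OF that] inv_thompson_line_group[of f] subsetD[OF 1 that] by simp
  show "g \<circ> f \<circ> finv g \<in> N" if "g \<in> thompson_line" "f \<in> N" for f g
    using N.inv_op_closed2[of g f] that by simp
qed

lemma finv_comp_thompson_line:
  "f \<in> thompson_line \<Longrightarrow> g \<in> thompson_line \<Longrightarrow> finv (f \<circ> g) = finv g \<circ> finv f"
  using thompson_line.inv_mult_group[of f g] by simp

lemma finv_finv_thompson_line [simp]: "f \<in> thompson_line \<Longrightarrow> finv (finv f) = f"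
  using thompson_line.inv_inv[of f] by simp

lemma dyadic_floor:
  assumes "0 \<le> t" "t \<le> (1::real)"
  obtains j :: int where "0 \<le> j" "j < 2 ^ n" "of_int j / 2 ^ n \<le> t" "t \<le> of_int j / 2 ^ n + 1 / 2 ^ n"
proof (cases "t = 1")
  case True
  \<comment> \<open>For \<open>t = 1\<close> the floor would give \<open>2 ^ n\<close>, one past the
    last interval.\<close>
  show thesis by (rule that[of "2 ^ n - 1"]) (auto simp: True field_simps)
next
  case False
  let ?j = "\<lfloor>t * 2 ^ n\<rfloor>"
  have "t * 2 ^ n < 2 ^ n" using False assms by simp
  then have "?j < 2 ^ n" by (simp add: floor_less_iff)
  moreover have "of_int ?j \<le> t * 2 ^ n" "t * 2 ^ n \<le> of_int ?j + 1" by linarith+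
  moreover have "0 \<le> ?j" using assms by simp
  ultimately show thesis using that[of ?j] by (simp add: field_simps)
qed

text \<open>
  Higman's trick: if \<open>k\<close> moves \<open>J\<close> off itself and \<open>F\<close>, \<open>G\<close> are supported in \<open>J\<close>, then
  \<open>[[F, k], G] = [F, G]\<close>.
\<close>

lemma normal_contains_base_commutator:
  assumes N: "N \<lhd> thompson_line_group" and nontrivial: "N \<noteq> {id}"
    and f: "f \<in> thompson_line" and g: "g \<in> thompson_line"
  shows "rescale (1/2) (1/4) (f \<circ> g \<circ> finv f \<circ> finv g) \<in> N"
proof -
  note ND = normal_thompson_lineD[OF N]
  obtain h x where h: "h \<in> N" "h x \<noteq> x" using nontrivial ND(2) by fastforce
  have hT: "h \<in> thompson_line" using h ND(1) by blast
  have x: "0 < x" "x < 1" using h(2) thompson_line_outside[OF hT, of x] by force+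
  \<comment> \<open>Conjugation by \<open>u\<close> moves the displaced point into
    \<open>[1/2, 3/4]\<close>, where standard intervals can be carried onto
    \<open>[1/2, 3/4]\<close>.\<close>
  obtain u where u: "u \<in> thompson_line" "u (min x (1 - x)) \<ge> 1/2" "u (1 - min x (1 - x)) \<le> 3/4"
    using squeeze_into_base[of "min x (1 - x)"] x by auto
  define y where "y = u x"
  have "u (min x (1 - x)) \<le> y" "y \<le> u (1 - min x (1 - x))"
    unfolding y_def using u(1) by (simp_all add: thompson_line_le_iff)
  then have y: "1/2 \<le> y" "y \<le> 3/4" using u by auto
  define k where "k = u \<circ> h \<circ> finv u"
  have k: "k \<in> N" unfolding k_def using ND(5) u h by blast
  then have kT: "k \<in> thompson_line" using ND(1) by blast
  have ky: "k y \<noteq> y" using h(2) u(1) by (simp add: k_def y_def thompson_line_eq_iff)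
  \<comment> \<open>Half the displacement of \<open>y\<close>: an interval around \<open>y\<close>
    shorter than \<open>r\<close>, whose image stays within \<open>r\<close> of \<open>k y\<close>,
    cannot meet that image.\<close>
  define r where "r = \<bar>k y - y\<bar> / 2"
  have "r > 0" using ky by (simp add: r_def)
  then obtain d where d: "d > 0" "\<And>z. \<bar>z - y\<bar> < d \<Longrightarrow> \<bar>k z - k y\<bar> < r"
    using thompson_line_isCont[OF kT, of y] by (auto simp: continuous_at_eps_delta dist_real_def)
  obtain n where n: "1 / 2 ^ n < min d r"
    using real_arch_pow_inv[of "min d r" "1 / 2"] d \<open>r > 0\<close> by (auto simp: power_one_over)
  \<comment> \<open>\<open>4 * y - 2\<close> is the position of \<open>y\<close> within
    \<open>[1/2, 3/4]\<close>.\<close>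
  obtain j where j: "0 \<le> j" "j < 2 ^ n" "of_int j / 2 ^ n \<le> 4 * y - 2" "4 * y - 2 \<le> of_int j / 2 ^ n + 1 / 2 ^ n"
    using dyadic_floor[of "4 * y - 2" n] y by auto
  define p q where "p = 1/2 + of_int j / 2 ^ n / (4::real)" and "q = 1 / 2 ^ n / (4::real)"
  have "0 < (1::real) / 2 ^ n" "4 * q = 1 / 2 ^ n" by (simp_all add: q_def)
  then have q: "0 < q" "q < d" "q < r" using n by linarith+
  have yJ: "y \<in> {p..p + q}" using j(3,4) by (auto simp: p_def q_def)
  have disjoint: "k z \<notin> {p..p + q}" if z: "z \<in> {p..p + q}" for z
  proof
    assume "k z \<in> {p..p + q}"
    then have "\<bar>k z - y\<bar> < r" using yJ q by auto
    moreover have "\<bar>k z - k y\<bar> < r" using yJ z q by (intro d(2)) auto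
    ultimately show False by (simp add: r_def abs_if split: if_splits)
  qed
  obtain w where w: "w \<in> thompson_line" "affine_match w (p, q) (1/2, 1/4)"
    using std_subinterval_to_base[OF j(1,2)] unfolding p_def q_def by blast
  have sub: "dyadic_subinterval p q"
  proof -
    have "real_of_int (j + 1) \<le> real_of_int (2 ^ n)" using j(2) by (simp only: of_int_le_iff)
    then have "p = of_int (2 * 2 ^ n + j) / 2 ^ (n + 2)" "q = 1 / 2 ^ (n + 2)"
      by (simp_all add: p_def q_def field_simps)
    moreover have "dyadic_subinterval (of_int (2 * 2 ^ n + j) / 2 ^ (n + 2)) (1 / 2 ^ (n + 2))"
      using j by (intro dyadic_subintervalI) auto
    ultimately show ?thesis by simp
  qed
  define F G where "F = rescale p q f" and "G = rescale p q g"
  have FG: "F \<in> thompson_line" "G \<in> thompson_line" using f g sub by (auto simp: F_def G_def)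
  \<comment> \<open>\<open>F \<circ> K\<close> is the commutator of \<open>F\<close> and
    \<open>k\<close>, hence in \<open>N\<close>, while \<open>K\<close> lives on the image under
    \<open>k\<close> of the interval carrying \<open>G\<close>.\<close>
  define K where "K = k \<circ> finv F \<circ> finv k"
  have K: "K \<in> thompson_line" using kT FG by (auto simp: K_def)
  have FK: "F \<circ> K \<in> N"
    using ND(3)[OF ND(5)[OF FG(1) k] ND(4)[OF k]] by (simp add: K_def comp_assoc)
  have KG: "K \<circ> G = G \<circ> K"
  proof (rule commute_disjoint_support[of _ _ "k ` {p..p + q}" "{p..p + q}"])
    show "inj K" "inj G" using K FG thompson_line_bij bij_is_inj by blast+
    show "k ` {p..p + q} \<inter> {p..p + q} = {}" using disjoint by auto
    show "G z = z" if "z \<notin> {p..p + q}" for z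
      using that q unfolding G_def by (intro rescale_outside[OF g]) auto
    show "K z = z" if z: "z \<notin> k ` {p..p + q}" for z
    proof -
      have "finv k z \<notin> {p..p + q}"
        using z inv_thompson_line_apply(2)[OF kT, of z] by (metis imageI)
      then have "finv k z \<notin> {p<..<p + q}" by auto
      then have "finv F (finv k z) = finv k z"
        using finv_rescale[OF f, of q p] q rescale_outside[OF thompson_line_inv[OF f], of q "finv k z" p]
        by (simp add: F_def)
      then show ?thesis using kT by (simp add: K_def)
    qed
  qed
  have "(F \<circ> K) \<circ> (G \<circ> finv (F \<circ> K) \<circ> finv G) \<in> N"
    using ND(3)[OF FK ND(5)[OF FG(2) ND(4)[OF FK]]] .
  also have "(F \<circ> K) \<circ> (G \<circ> finv (F \<circ> K) \<circ> finv G) = F \<circ> (K \<circ> G) \<circ> finv K \<circ> finv F \<circ> finv G"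
    using FG K by (simp add: finv_comp_thompson_line comp_assoc)
  also have "\<dots> = F \<circ> G \<circ> finv F \<circ> finv G"
    unfolding KG using K by (simp add: fun_eq_iff)
  also have "\<dots> = rescale p q (f \<circ> g \<circ> finv f \<circ> finv g)"
    using q f g by (simp add: F_def G_def finv_rescale rescale_comp)
  finally have "rescale p q (f \<circ> g \<circ> finv f \<circ> finv g) \<in> N" .
  then have "w \<circ> rescale p q (f \<circ> g \<circ> finv f \<circ> finv g) \<circ> finv w \<in> N" using ND(5) w(1) by blast
  then show ?thesis using rescale_conj[OF _ w] f g by simp
qed

text \<open>Both directions serve the induction below: from the small interval to the large one for
  \<open>x0\<close>, from the large one to its halves for \<open>thompson_join\<close>.\<close>

lemma normal_contains_base_subinterval:
  assumes N: "N \<lhd> thompson_line_group" and f: "f \<in> thompson_line" and j: "0 \<le> j" "j < 2 ^ n"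
  shows "rescale (1/2 + of_int j / 2 ^ n / 4) (1 / 2 ^ n / 4) f \<in> N \<longleftrightarrow> rescale (1/2) (1/4) f \<in> N"
proof -
  note ND = normal_thompson_lineD[OF N]
  obtain w where w: "w \<in> thompson_line" "affine_match w (1/2 + of_int j / 2 ^ n / 4, 1 / 2 ^ n / 4) (1/2, 1/4)"
    using std_subinterval_to_base[OF j] by blast
  define a where "a = rescale (1/2 + of_int j / 2 ^ n / 4) (1 / 2 ^ n / 4) f"
  have eq: "w \<circ> a \<circ> finv w = rescale (1/2) (1/4) f"
    unfolding a_def by (rule rescale_conj[OF f w])
  have "finv w \<circ> (w \<circ> a \<circ> finv w) \<circ> finv (finv w) = a"
    using w(1) by (simp add: fun_eq_iff)
  then show ?thesis
    using ND(5)[OF w(1), of a] ND(5)[OF thompson_line_inv[OF w(1)], of "rescale (1/2) (1/4) f"] eq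
    unfolding a_def[symmetric] by auto
qed

lemma normal_contains_base:
  assumes N: "N \<lhd> thompson_line_group" and nontrivial: "N \<noteq> {id}" and f: "f \<in> thompson_line"
  shows "rescale (1/2) (1/4) f \<in> N"
  using f
proof (induction rule: thompson_line_induct)
  case id
  show ?case using normal_thompson_lineD(2)[OF N] rescale_id[of "1/4" "1/2"] by (simp add: id_def)
next
  case x0
  \<comment> \<open>The pentagon is used inside the left half, so that the unscaled
    \<open>x0\<close> is available to conjugate the copy on \<open>[0, 1/4]\<close> to
    \<open>y\<close>.\<close>
  define y where "y = rescale 0 (1/2) x0"
  have y: "y \<in> thompson_line" by (auto simp: y_def)
  have 1: "x0 \<circ> rescale 0 (1/4) x0 \<circ> finv x0 = y"
    unfolding y_def by (rule rescale_conj) (auto simp: affine_match_def x0_def)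
  have "rescale 0 (1/2) (rescale (1/2) (1/2) x0 \<circ> x0 \<circ> rescale 0 (1/2) x0) = rescale 0 (1/2) (x0 \<circ> x0)"
    by (simp only: pentagon)
  then have 2: "rescale (1/4) (1/4) x0 \<circ> y \<circ> rescale 0 (1/4) x0 = y \<circ> y"
    by (simp add: y_def rescale_rescale flip: rescale_comp)
  have z: "rescale 0 (1/4) x0 \<in> thompson_line" by auto
  have 3: "rescale 0 (1/4) x0 = finv x0 \<circ> y \<circ> x0"
    unfolding 1[symmetric] by (simp add: fun_eq_iff)
  \<comment> \<open>Solving the pentagon for the copy on \<open>[1/4, 1/2]\<close> and inserting
    \<open>3\<close> leaves a conjugate by \<open>y\<close> of the commutator of \<open>y\<close>
    and \<open>finv x0\<close>.\<close>
  have "rescale (1/4) (1/4) x0 = (rescale (1/4) (1/4) x0 \<circ> y \<circ> rescale 0 (1/4) x0) \<circ> finv (rescale 0 (1/4) x0) \<circ> finv y"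
    using y z by (simp add: fun_eq_iff)
  also have "\<dots> = y \<circ> (y \<circ> finv x0 \<circ> finv y \<circ> finv (finv x0)) \<circ> finv y"
    unfolding 2 unfolding 3 using y by (simp add: finv_comp_thompson_line comp_assoc)
  finally have eq: "rescale (1/4) (1/4) x0 = y \<circ> (y \<circ> finv x0 \<circ> finv y \<circ> finv (finv x0)) \<circ> finv y" .
  let ?e = "rescale (1/2) (1/4)"
  have "?e (y \<circ> finv x0 \<circ> finv y \<circ> finv (finv x0)) \<in> N"
    using y by (intro normal_contains_base_commutator[OF N nontrivial]) auto
  then have "?e y \<circ> ?e (y \<circ> finv x0 \<circ> finv y \<circ> finv (finv x0)) \<circ> finv (?e y) \<in> N"
    using y by (intro normal_thompson_lineD(5)[OF N]) auto
  then have "?e (rescale (1/4) (1/4) x0) \<in> N"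
    unfolding eq using y by (simp add: finv_rescale rescale_comp)
  \<comment> \<open>The copy obtained lives on \<open>[9/16, 5/8]\<close>, which has index 1 at
    level 2 inside \<open>[1/2, 3/4]\<close>.\<close>
  then show ?case
    using normal_contains_base_subinterval[OF N x0_thompson_line, of 1 2] by (simp add: rescale_rescale)
next
  case (inv f)
  then show ?case using normal_thompson_lineD(4)[OF N] by (metis finv_rescale divide_eq_0_iff zero_neq_numeral one_neq_zero)
next
  case (comp f g)
  then show ?case using normal_thompson_lineD(3)[OF N, of "rescale (1/2) (1/4) f" "rescale (1/2) (1/4) g"]
    by (simp add: rescale_comp) (simp add: comp_def)
next
  case (join f g)
  have "rescale (1/2) (1/8) f \<in> N" "rescale (5/8) (1/8) g \<in> N"
    using join normal_contains_base_subinterval[OF N, of f 0 1] normal_contains_base_subinterval[OF N, of g 1 1]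
    by simp_all
  then have "rescale (1/2) (1/8) f \<circ> rescale (5/8) (1/8) g \<in> N" by (rule normal_thompson_lineD(3)[OF N])
  moreover have "rescale (1/2) (1/4) (thompson_join f g) = rescale (1/2) (1/8) f \<circ> rescale (5/8) (1/8) g"
    by (simp add: thompson_join_def rescale_rescale flip: rescale_comp)
  ultimately show ?case by (simp add: comp_def)
qed

lemma normal_contains_compactly_supported:
  assumes N: "N \<lhd> thompson_line_group" and nontrivial: "N \<noteq> {id}" and f: "f \<in> thompson_line"
    and e: "e > 0" "\<And>x. x \<le> e \<Longrightarrow> f x = x" "\<And>x. 1 - e \<le> x \<Longrightarrow> f x = x"
  shows "f \<in> N"
proof -
  obtain u where u: "u \<in> thompson_line" "u e \<ge> 1/2" "u (1 - e) \<le> 3/4"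
    using squeeze_into_base[OF e(1)] .
  define g where "g = u \<circ> f \<circ> finv u"
  have g: "g \<in> thompson_line" using u f by (auto simp: g_def)
  have gx: "g x = x" if "x \<notin> {1/2<..<3/4}" for x
  proof -
    have "u (finv u x) = x" using u by simp
    then have "finv u x \<le> e \<or> 1 - e \<le> finv u x"
      using that u thompson_line_le_iff[OF u(1), of "finv u x" e] thompson_line_le_iff[OF u(1), of "1 - e" "finv u x"]
      by auto
    then have "f (finv u x) = finv u x" using e by blast
    then show ?thesis using u by (simp add: g_def)
  qed
  \<comment> \<open>The inverse of copying to \<open>[1/2, 3/4]\<close>: the map
    \<open>-2 + 4 * x\<close> takes this interval to the unit interval. As \<open>[-2, 2]\<close> is
    no subinterval of the unit interval, membership is checked by hand from the support of
    \<open>g\<close>.\<close>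
  define f' where "f' = rescale (-2) 4 g"
  have "f' \<in> thompson_line"
  proof -
    have "locally_dyadic f'" "strict_mono f'"
      using rescale_locally_dyadic[of g "-2" 2] g dyadic_of_int[of "-2" 0]
      by (auto simp: f'_def thompson_line_def)
    moreover have "f' x = x" if "x \<notin> {0<..<1}" for x
      using gx[of "(x + 2) / 4"] that by (auto simp: f'_def rescale_def)
    ultimately show ?thesis by (simp add: thompson_line_def)
  qed
  then have "rescale (1/2) (1/4) f' \<in> N" by (rule normal_contains_base[OF N nontrivial])
  moreover have "rescale (1/2) (1/4) f' = g"
    unfolding f'_def by (subst rescale_rescale) (simp_all add: rescale_def)
  ultimately have "g \<in> N" by simp
  then have "finv u \<circ> g \<circ> finv (finv u) \<in> N"
    using u by (intro normal_thompson_lineD(5)[OF N]) auto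
  moreover have "finv u \<circ> g \<circ> finv (finv u) = f" using u by (simp add: g_def fun_eq_iff)
  ultimately show ?thesis by simp
qed

section \<open>Germs at the end points and centralizers\<close>

definition has_germ :: "(real \<Rightarrow> real) \<Rightarrow> real \<Rightarrow> bool" where
  "has_germ f s \<longleftrightarrow> (\<exists>e>0. \<forall>x\<in>{0..e}. f x = s * x)"

text \<open>Conjugation by the reflection of the unit interval, so that germs at 1 become germs at 0
  and one set of lemmas serves both ends.\<close>

definition flip :: "(real \<Rightarrow> real) \<Rightarrow> real \<Rightarrow> real" where
  "flip f x = 1 - f (1 - x)"

lemma flip_comp: "flip (f \<circ> g) = flip f \<circ> flip g"
  by (simp add: flip_def fun_eq_iff)

lemma flip_id [simp]: "flip id = id"
  by (simp add: flip_def fun_eq_iff)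

lemma has_germ_id: "has_germ id 1"
  unfolding has_germ_def by (intro exI[of _ 1]) auto

lemma has_germ_unique:
  assumes "has_germ f s" "has_germ f t"
  shows "s = t"
proof -
  obtain d e where d: "d > 0" "\<And>x. x \<in> {0..d} \<Longrightarrow> f x = s * x"
    and e: "e > 0" "\<And>x. x \<in> {0..e} \<Longrightarrow> f x = t * x"
    using assms by (auto simp: has_germ_def)
  define x where "x = min d e"
  have x: "0 < x" "x \<le> d" "x \<le> e" using d(1) e(1) by (simp_all add: x_def)
  have "s * x = t * x" using d(2)[of x] e(2)[of x] x by simp
  with x show ?thesis by simp
qed

lemma has_germ_comp:
  assumes "has_germ f s" "has_germ g t" "t > 0"
  shows "has_germ (f \<circ> g) (s * t)"
proof -
  obtain d e where d: "d > 0" "\<And>x. x \<in> {0..d} \<Longrightarrow> f x = s * x"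
    and e: "e > 0" "\<And>x. x \<in> {0..e} \<Longrightarrow> g x = t * x"
    using assms by (auto simp: has_germ_def)
  have "(f \<circ> g) x = s * t * x" if "x \<in> {0..min e (d / t)}" for x
  proof -
    have "t * x \<in> {0..d}" using that \<open>t > 0\<close> by (auto simp: field_simps)
    then show ?thesis using that d e by simp
  qed
  moreover have "min e (d / t) > 0" using d e \<open>t > 0\<close> by simp
  ultimately show ?thesis unfolding has_germ_def by blast
qed

lemma has_germ_left_inverse:
  assumes "has_germ f s" "s > 0" "g \<circ> f = id"
  shows "has_germ g (1 / s)"
proof -
  obtain e where e: "e > 0" "\<And>x. x \<in> {0..e} \<Longrightarrow> f x = s * x"
    using assms by (auto simp: has_germ_def)
  have "g x = 1 / s * x" if "x \<in> {0..s * e}" for x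
  proof -
    have "x / s \<in> {0..e}" using that \<open>s > 0\<close> by (auto simp: field_simps)
    then have "f (x / s) = x" using e \<open>s > 0\<close> by simp
    then show ?thesis using fun_cong[OF assms(3), of "x / s"] by simp
  qed
  moreover have "s * e > 0" using e \<open>s > 0\<close> by simp
  ultimately show ?thesis unfolding has_germ_def by blast
qed

lemma has_germ_inv:
  assumes "f \<in> thompson_line" "s > 0"
  shows "has_germ f s \<Longrightarrow> has_germ (finv f) (1 / s)"
    "has_germ (flip f) s \<Longrightarrow> has_germ (flip (finv f)) (1 / s)"
  using assms by (auto intro!: has_germ_left_inverse simp flip: flip_comp)

lemma has_germ_funpow:
  assumes "s > 0"
  shows "has_germ f s \<Longrightarrow> has_germ (f ^^ n) (s ^ n)"
    "has_germ (flip f) s \<Longrightarrow> has_germ (flip (f ^^ n)) (s ^ n)"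
proof -
  show "has_germ f s \<Longrightarrow> has_germ (f ^^ n) (s ^ n)" for f
    by (induction n) (use assms has_germ_id in \<open>auto intro!: has_germ_comp simp: id_def\<close>)
  moreover have "flip (f ^^ n) = flip f ^^ n"
    by (induction n) (simp_all only: funpow.simps flip_id flip_comp)
  ultimately show "has_germ (flip f) s \<Longrightarrow> has_germ (flip (f ^^ n)) (s ^ n)" by simp
qed

lemma thompson_line_has_germ:
  assumes f: "f \<in> thompson_line"
  obtains k l :: int where "has_germ f (2 powi k)" "has_germ (flip f) (2 powi l)"
proof -
  have loc: "locally_dyadic f" using f by (simp add: thompson_line_def)
  obtain e where e: "e > 0" "dyadic_affine_on {0..0 + e} f"
    using locally_dyadic_uniform_radius[OF loc] by metis
  then obtain k :: int and c where k: "\<And>x. x \<in> {0..e} \<Longrightarrow> f x = 2 powi k * x + c"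
    by (auto simp: dyadic_affine_on_def dyadic_affine_def)
  have "c = 0" using k[of 0] e f by (simp add: thompson_line_0)
  then have germ: "has_germ f (2 powi k)"
    unfolding has_germ_def using e k by auto
  obtain e' where e': "e' > 0" "dyadic_affine_on {1 - e'..1} f"
    using locally_dyadic_uniform_radius[OF loc] by metis
  then obtain l :: int and d where l: "\<And>x. x \<in> {1 - e'..1} \<Longrightarrow> f x = 2 powi l * x + d"
    by (auto simp: dyadic_affine_on_def dyadic_affine_def)
  have "d = 1 - 2 powi l" using l[of 1] e' f by (simp add: thompson_line_1)
  then have "\<forall>x\<in>{0..e'}. flip f x = 2 powi l * x"
    using l by (auto simp: flip_def algebra_simps)
  then have "has_germ (flip f) (2 powi l)"
    unfolding has_germ_def using e' by blast
  with germ show thesis by (rule that)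
qed

lemma two_powi_inject:
  assumes "(2::real) powi k = 2 powi l"
  shows "k = l"
proof (rule ccontr)
  assume "k \<noteq> l"
  then have "(2::real) powi k < 2 powi l \<or> (2::real) powi l < 2 powi k"
    by (metis linorder_neqE one_less_numeral_iff power_int_strict_increasing semiring_norm(76))
  then show False using assms by simp
qed

text \<open>The kernel of the homomorphism to the integers that sends an element with slopes
  \<open>2 powi k\<close> at 0 and \<open>2 powi l\<close> at 1 to \<open>l + m * k\<close>.\<close>

definition germ_line :: "int \<Rightarrow> (real \<Rightarrow> real) set" where
  "germ_line m = {f \<in> thompson_line. \<exists>k::int. has_germ f (2 powi k) \<and> has_germ (flip f) (2 powi (- m * k))}"

lemma germ_line_normal: "germ_line m \<lhd> thompson_line_group"
proof -
  have comp: "f \<circ> g \<in> germ_line m" if fg: "f \<in> germ_line m" "g \<in> germ_line m" for f g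
  proof -
    obtain k l :: int where k: "has_germ f (2 powi k)" "has_germ (flip f) (2 powi (- m * k))"
      and l: "has_germ g (2 powi l)" "has_germ (flip g) (2 powi (- m * l))"
      using fg by (auto simp: germ_line_def)
    have "has_germ (f \<circ> g) (2 powi (k + l))"
      using has_germ_comp[OF k(1) l(1)] by (simp add: power_int_add)
    moreover have "2 powi (- m * k) * 2 powi (- m * l) = (2::real) powi (- m * (k + l))"
      by (subst power_int_add[symmetric]) (simp_all add: algebra_simps)
    then have "has_germ (flip (f \<circ> g)) (2 powi (- m * (k + l)))"
      using has_germ_comp[OF k(2) l(2)] by (simp add: flip_comp)
    ultimately show ?thesis using fg by (auto simp: germ_line_def)
  qed
  have inv: "finv f \<in> germ_line m" if f: "f \<in> germ_line m" for f
  proof -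
    have fT: "f \<in> thompson_line" using f by (simp add: germ_line_def)
    obtain k :: int where k: "has_germ f (2 powi k)" "has_germ (flip f) (2 powi (- m * k))"
      using f by (auto simp: germ_line_def)
    have "has_germ (finv f) (2 powi (- k))"
      using has_germ_inv(1)[OF fT _ k(1)] by (simp add: power_int_minus divide_inverse)
    moreover have "has_germ (flip (finv f)) (2 powi (- m * - k))"
      using has_germ_inv(2)[OF fT _ k(2)] by (simp add: power_int_minus divide_inverse)
    ultimately show ?thesis using fT by (auto simp: germ_line_def)
  qed
  have conj: "g \<circ> f \<circ> finv g \<in> germ_line m" if f: "f \<in> germ_line m" and g: "g \<in> thompson_line" for f g
  proof -
    obtain k :: int where k: "has_germ f (2 powi k)" "has_germ (flip f) (2 powi (- m * k))"
      using f by (auto simp: germ_line_def)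
    obtain i j :: int where ij: "has_germ g (2 powi i)" "has_germ (flip g) (2 powi j)"
      using thompson_line_has_germ[OF g] .
    have "has_germ (g \<circ> f \<circ> finv g) (2 powi i * 2 powi k * (1 / 2 powi i))"
      by (intro has_germ_comp has_germ_inv ij k g) auto
    moreover have "has_germ (flip (g \<circ> f \<circ> finv g)) (2 powi j * 2 powi (- m * k) * (1 / 2 powi j))"
      unfolding flip_comp by (intro has_germ_comp has_germ_inv ij k g) auto
    moreover have "f \<in> thompson_line" using f by (simp add: germ_line_def)
    ultimately show ?thesis using g by (auto simp: germ_line_def)
  qed
  have sub: "germ_line m \<subseteq> thompson_line" by (auto simp: germ_line_def)
  have "id \<in> germ_line m"
    using has_germ_id by (auto simp: germ_line_def intro!: exI[of _ 0])
  then have "subgroup (germ_line m) thompson_line_group"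
    by unfold_locales (use sub comp inv in \<open>auto simp: subset_iff\<close>)
  then show ?thesis
    unfolding thompson_line.normal_inv_iff using conj by simp
qed

text \<open>Iterates of \<open>y\<close> dominate those of \<open>x0\<close> and push
  \<open>e\<close> past every \<open>x < 1\<close>. Hence \<open>x = (y ^^ n) z\<close> with
  \<open>z\<close> in \<open>{0..e}\<close>, and commuting with \<open>y\<close> transports the
  agreement from \<open>z\<close> to \<open>x\<close>.\<close>

lemma commuting_agree:
  assumes y: "y \<in> thompson_line" "\<And>x. y x \<ge> x0 x"
    and f: "f \<in> thompson_line" "f \<circ> y = y \<circ> f" and g: "g \<in> thompson_line" "g \<circ> y = y \<circ> g"
    and e: "e > 0" "\<And>x. x \<in> {0..e} \<Longrightarrow> f x = g x"
  shows "f = g"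
proof
  fix x
  have pow: "h ((y ^^ n) z) = (y ^^ n) (h z)" if "h \<circ> y = y \<circ> h" for h n z
    by (induction n) (use fun_cong[OF that] in auto)
  have ge: "(y ^^ n) z \<ge> (x0 ^^ n) z" for n z
  proof (induction n)
    case (Suc n)
    then have "x0 ((x0 ^^ n) z) \<le> x0 ((y ^^ n) z)"
      using thompson_line_le_iff[OF x0_thompson_line] by blast
    also have "\<dots> \<le> y ((y ^^ n) z)" by (rule y(2))
    finally show ?case by simp
  qed simp
  show "f x = g x"
  proof (cases "x \<in> {0<..<1}")
    case True
    then obtain n where n: "(x0 ^^ n) e > x" using x0_iterate_exceeds[OF e(1), of x] by auto
    have yn: "y ^^ n \<in> thompson_line" using y by auto
    define z where "z = finv (y ^^ n) x"
    have x: "x = (y ^^ n) z" using yn by (simp add: z_def)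
    have "(y ^^ n) z \<le> (y ^^ n) e" using n ge[of n e] x by linarith
    moreover have "(y ^^ n) 0 \<le> (y ^^ n) z" using True x thompson_line_0[OF yn] by simp
    ultimately have "z \<in> {0..e}" using thompson_line_le_iff[OF yn] by simp
    then show ?thesis using e pow[OF f(2)] pow[OF g(2)] by (simp add: x)
  next
    case False
    then show ?thesis using thompson_line_outside[OF f(1) False] thompson_line_outside[OF g(1) False] by simp
  qed
qed

text \<open>Since \<open>y\<close> has slope 2 at 0, the slope of \<open>f\<close> there is that of
  the \<open>k\<close>-th power of \<open>y\<close>. Agreement near 0 makes \<open>f\<close> equal
  to this power, which dictates the slope at 1.\<close>

lemma centralizer_subset_germ_line:
  assumes y: "y \<in> thompson_line" "\<And>x. y x \<ge> x0 x"
    and germ: "has_germ y 2" "has_germ (flip y) (2 powi (- m))"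
  shows "centralizer thompson_line_group y \<subseteq> germ_line m"
proof
  fix f assume "f \<in> centralizer thompson_line_group y"
  then have f: "f \<in> thompson_line" "f \<circ> y = y \<circ> f" by (auto simp: centralizer_def)
  obtain k l :: int where kl: "has_germ f (2 powi k)" "has_germ (flip f) (2 powi l)"
    using thompson_line_has_germ[OF f(1)] .
  \<comment> \<open>Negative and positive part of \<open>k\<close>: the equation
    \<open>f \<circ> y ^^ i = y ^^ j\<close> says that \<open>f\<close> is the \<open>k\<close>-th
    power of \<open>y\<close> without using negative powers.\<close>
  define i j where "i = nat (- k)" and "j = nat k"
  have ij: "k + int i = int j" by (simp add: i_def j_def)
  have pow: "2 powi k * 2 ^ i = (2::real) ^ j"
    using power_int_add[of "2::real" k "int i"] unfolding ij by simp
  have comm: "y ^^ n \<circ> y = y \<circ> y ^^ n" for n by (metis funpow_Suc_right funpow.simps(2))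
  have 1: "has_germ (f \<circ> y ^^ i) (2 ^ j)"
    using has_germ_comp[OF kl(1) has_germ_funpow(1)[OF _ germ(1), of i]] pow by simp
  have 2: "has_germ (y ^^ j) (2 ^ j)" using has_germ_funpow(1)[OF _ germ(1)] by simp
  obtain d where d: "d > 0" "\<forall>x\<in>{0..d}. (f \<circ> y ^^ i) x = 2 ^ j * x"
    using 1 by (auto simp: has_germ_def)
  obtain e where e: "e > 0" "\<forall>x\<in>{0..e}. (y ^^ j) x = 2 ^ j * x"
    using 2 by (auto simp: has_germ_def)
  have eq: "f \<circ> y ^^ i = y ^^ j"
  proof (rule commuting_agree[OF y])
    show "f \<circ> y ^^ i \<in> thompson_line" "y ^^ j \<in> thompson_line" using f y by auto
    show "f \<circ> y ^^ i \<circ> y = y \<circ> (f \<circ> y ^^ i)"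
      using comm[of i] f(2) by (metis comp_assoc)
    show "y ^^ j \<circ> y = y \<circ> y ^^ j" by (rule comm)
    show "min d e > 0" using d e by simp
    show "(f \<circ> y ^^ i) x = (y ^^ j) x" if "x \<in> {0..min d e}" for x
      using that d e by simp
  qed
  have "has_germ (flip (f \<circ> y ^^ i)) (2 powi l * (2 powi (- m)) ^ i)"
    unfolding flip_comp by (intro has_germ_comp kl has_germ_funpow germ) auto
  moreover have "has_germ (flip (y ^^ j)) ((2 powi (- m)) ^ j)"
    by (intro has_germ_funpow germ) auto
  ultimately have "2 powi l * (2 powi (- m)) ^ i = (2 powi (- m) :: real) ^ j"
    unfolding eq by (rule has_germ_unique)
  moreover have "(2 powi (- m) :: real) ^ n = 2 powi (- m * int n)" for n
    by (simp only: power_int_mult power_int_of_nat)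
  ultimately have "(2::real) powi (l + - m * int i) = 2 powi (- m * int j)"
    by (subst power_int_add) simp_all
  then have "l + - m * int i = - m * int j" by (rule two_powi_inject)
  then have "l = - m * (int j - int i)" by (simp add: algebra_simps)
  then have "l = - m * k" using ij by simp
  then show "f \<in> germ_line m" using f(1) kl by (auto simp: germ_line_def)
qed

text \<open>The two lines of exponents meet only in \<open>k = 0\<close>, so the elements concerned
  are the identity near both end points.\<close>

lemma germ_lines_subset_normal:
  assumes "N \<lhd> thompson_line_group" "N \<noteq> {id}"
  shows "germ_line 1 \<inter> germ_line 2 \<subseteq> N"
proof
  fix f assume f: "f \<in> germ_line 1 \<inter> germ_line 2"
  then obtain k l :: int where kl: "has_germ f (2 powi k)" "has_germ (flip f) (2 powi (- k))"
    "has_germ f (2 powi l)" "has_germ (flip f) (2 powi (- 2 * l))"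
    by (auto simp: germ_line_def)
  have "(2::real) powi k = 2 powi l" "(2::real) powi (- k) = 2 powi (- 2 * l)"
    using kl has_germ_unique by blast+
  then have "k = l" "- k = - 2 * l" by (blast dest: two_powi_inject)+
  then have "k = 0" by simp
  then have "has_germ f 1" "has_germ (flip f) 1" using kl by simp_all
  then obtain d e where d: "d > 0" "\<And>x. x \<in> {0..d} \<Longrightarrow> f x = x"
    and e: "e > 0" "\<And>x. x \<in> {0..e} \<Longrightarrow> 1 - f (1 - x) = x"
    by (auto simp: has_germ_def flip_def)
  have fT: "f \<in> thompson_line" using f by (simp add: germ_line_def)
  show "f \<in> N"
  proof (rule normal_contains_compactly_supported[OF assms fT])
    show "min d e > 0" using d e by simp
    show "f x = x" if "x \<le> min d e" for x
      using that d(2)[of x] thompson_line_outside[OF fT, of x] by (cases "x \<ge> 0") auto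
    show "f x = x" if "1 - min d e \<le> x" for x
      using that e(2)[of "1 - x"] thompson_line_outside[OF fT, of x] by (cases "x \<le> 1") auto
  qed
qed

text \<open>The slopes of a commutator cancel at both ends, and the exponent pair
  \<open>(0, 0)\<close> lies on every line.\<close>

lemma derived_subset_germ_line: "derived thompson_line_group thompson_line \<subseteq> germ_line m"
proof -
  have "f \<circ> g \<circ> finv f \<circ> finv g \<in> germ_line m" if fg: "f \<in> thompson_line" "g \<in> thompson_line" for f g
  proof -
    obtain k l :: int where k: "has_germ f (2 powi k)" "has_germ (flip f) (2 powi l)"
      using thompson_line_has_germ[OF fg(1)] .
    obtain i j :: int where i: "has_germ g (2 powi i)" "has_germ (flip g) (2 powi j)"
      using thompson_line_has_germ[OF fg(2)] .
    have "has_germ (f \<circ> g \<circ> finv f \<circ> finv g) (2 powi k * 2 powi i * (1 / 2 powi k) * (1 / 2 powi i))"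
      by (intro has_germ_comp has_germ_inv k i fg) auto
    moreover have "has_germ (flip (f \<circ> g \<circ> finv f \<circ> finv g)) (2 powi l * 2 powi j * (1 / 2 powi l) * (1 / 2 powi j))"
      unfolding flip_comp by (intro has_germ_comp has_germ_inv k i fg) auto
    ultimately show ?thesis using fg by (auto simp: germ_line_def intro!: exI[of _ 0])
  qed
  then show ?thesis
    unfolding derived_def
    by (intro thompson_line.generate_subgroup_incl normal_imp_subgroup germ_line_normal) auto
qed

lemma derived_thompson_line_nontrivial: "derived thompson_line_group thompson_line \<noteq> {id}"
proof
  assume *: "derived thompson_line_group thompson_line = {id}"
  let ?x1 = "rescale (1/2) (1/2) x0"
  have x1: "?x1 \<in> thompson_line" by auto
  have "x0 \<circ> ?x1 \<circ> finv x0 \<circ> finv ?x1 \<in> derived thompson_line_group thompson_line"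
    unfolding derived_def using x1 by (intro generate.incl) fastforce
  then have "x0 \<circ> ?x1 \<circ> finv x0 \<circ> finv ?x1 = id" using * by simp
  \<comment> \<open>Evaluating at \<open>?x1 (x0 (3/8))\<close> undoes the two inverses. The order
    matters at 3/8: \<open>?x1\<close> fixes it, but \<open>x0\<close> takes it to 5/8, which
    \<open>?x1\<close> moves.\<close>
  then have "(x0 \<circ> ?x1 \<circ> finv x0 \<circ> finv ?x1) (?x1 (x0 (3/8))) = ?x1 (x0 (3/8))" by simp
  then have "x0 (?x1 (3/8)) = ?x1 (x0 (3/8))" using x1 by simp
  then show False by (simp add: x0_right x0_def)
qed

lemma pseudocentre_thompson_line_group:
  "pseudocentre thompson_line_group = derived thompson_line_group thompson_line"
proof
  let ?D = "derived thompson_line_group thompson_line" and ?x1 = "rescale (1/2) (1/2) x0"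
  have 1: "centralizer thompson_line_group x0 \<subseteq> germ_line 1"
  proof (rule centralizer_subset_germ_line)
    show "has_germ x0 2"
      unfolding has_germ_def by (rule exI[of _ "1/4"]) (auto simp: x0_def)
    show "has_germ (flip x0) (2 powi - 1)"
      unfolding has_germ_def
      by (rule exI[of _ "1/2"]) (auto simp: x0_def flip_def power_int_minus diff_divide_distrib)
  qed auto
  \<comment> \<open>\<open>?x1\<close> is trivial near 0 and has slope 1/2 at 1, so composing with
    it halves the slope of \<open>x0\<close> at 1 once more. It moves no point to the left, so the
    product stays above \<open>x0\<close>.\<close>
  have 2: "centralizer thompson_line_group (?x1 \<circ> x0) \<subseteq> germ_line 2"
  proof (rule centralizer_subset_germ_line)
    show "has_germ (?x1 \<circ> x0) 2"
      unfolding has_germ_def by (rule exI[of _ "1/4"]) (auto simp: x0_def x0_right)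
    show "has_germ (flip (?x1 \<circ> x0)) (2 powi - 2)"
      unfolding has_germ_def
    proof (intro exI[of _ "1/4"] conjI ballI)
      fix x :: real assume "x \<in> {0..1/4}"
      then have "x0 (1 - x) = 1 - x / 2" "?x1 (1 - x / 2) = 1 - x / 4"
        by (auto simp: x0_def x0_right)
      then show "flip (?x1 \<circ> x0) x = 2 powi - 2 * x" by (simp add: flip_def power_int_minus)
    qed simp
    show "x0 x \<le> (?x1 \<circ> x0) x" for x unfolding comp_apply x0_right by simp
  qed auto
  have "pseudocentre thompson_line_group \<subseteq> normal_closure thompson_line_group (centralizer thompson_line_group y)"
    if "y \<in> thompson_line" for y
    using that by (auto simp: pseudocentre_def)
  moreover have "normal_closure thompson_line_group A \<subseteq> germ_line m" if "A \<subseteq> germ_line m" for A m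
    using that germ_line_normal by (auto simp: normal_closure_def)
  ultimately have "pseudocentre thompson_line_group \<subseteq> germ_line 1 \<inter> germ_line 2"
    using 1 2 by (meson le_inf_iff order_trans x0_thompson_line thompson_line_comp
        rescale_thompson_line dyadic_subinterval_basic(2))
  also have "\<dots> \<subseteq> ?D"
    using germ_lines_subset_normal thompson_line.derived_self_is_normal derived_thompson_line_nontrivial
    by simp
  finally show "pseudocentre thompson_line_group \<subseteq> ?D" .
  have "?D \<subseteq> N" if y: "y \<in> thompson_line" and N: "N \<lhd> thompson_line_group"
    "centralizer thompson_line_group y \<subseteq> N" for y N
  proof -
    \<comment> \<open>Either \<open>y\<close> is a nontrivial element of its own centralizer, or
      \<open>y\<close> is the identity and its centralizer is the whole group.\<close>
    have "N \<noteq> {id}"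
    proof
      assume "N = {id}"
      moreover have "y \<in> centralizer thompson_line_group y" using y by (simp add: centralizer_def)
      ultimately have "y = id" using N by blast
      then have "x0 \<in> centralizer thompson_line_group y" by (simp add: centralizer_def)
      then have "x0 = id" using N \<open>N = {id}\<close> by blast
      then have "x0 (1/4) = 1/4" by simp
      then show False by (simp add: x0_def)
    qed
    then show ?thesis
      using germ_lines_subset_normal[OF N(1)] derived_subset_germ_line by blast
  qed
  then show "?D \<subseteq> pseudocentre thompson_line_group"
    by (force simp: pseudocentre_def normal_closure_def)
qed

text \<open>A normal subgroup of \<open>H\<close> containing the centralizer of \<open>y\<close> is
  carried by the inverse isomorphism to one of \<open>G\<close> containing the centralizer of
  \<open>\<psi> y\<close>. Applied to the inverse isomorphism, this inclusion also gives the
  opposite one.\<close>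

lemma iso_pseudocentre_subset:
  assumes G: "group G" and H: "group H" and \<phi>: "\<phi> \<in> iso G H"
  shows "\<phi> ` pseudocentre G \<subseteq> pseudocentre H"
proof -
  interpret G: group G by (rule G)
  define \<psi> where "\<psi> = inv_into (carrier G) \<phi>"
  have \<psi>: "\<psi> \<in> iso H G" unfolding \<psi>_def by (rule G.iso_set_sym[OF \<phi>])
  have bij: "bij_betw \<phi> (carrier G) (carrier H)" and hom: "\<phi> \<in> hom G H"
    using \<phi> by (auto simp: iso_def)
  have \<phi>\<psi>: "\<phi> (\<psi> y) = y" "\<psi> y \<in> carrier G" if "y \<in> carrier H" for y
    using that bij bij_betw_inv_into_right bij_betwE[OF bij_betw_inv_into] by (fastforce simp: \<psi>_def)+
  have \<psi>\<phi>: "\<psi> (\<phi> x) = x" "\<phi> x \<in> carrier H" if "x \<in> carrier G" for x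
    using that bij bij_betw_inv_into_left bij_betwE by (fastforce simp: \<psi>_def)+
  have "\<phi> p \<in> N" if p: "p \<in> pseudocentre G" and y: "y \<in> carrier H"
    and N: "N \<lhd> H" "centralizer H y \<subseteq> N" for p y N
  proof -
    have "\<psi> ` N \<lhd> G" by (rule iso_normal_subgroup[OF \<psi> H G N(1)])
    moreover have "centralizer G (\<psi> y) \<subseteq> \<psi> ` N"
    proof
      fix g assume "g \<in> centralizer G (\<psi> y)"
      then have g: "g \<in> carrier G" "g \<otimes>\<^bsub>G\<^esub> \<psi> y = \<psi> y \<otimes>\<^bsub>G\<^esub> g" by (auto simp: centralizer_def)
      then have "\<phi> g \<otimes>\<^bsub>H\<^esub> y = y \<otimes>\<^bsub>H\<^esub> \<phi> g"
        using hom_mult[OF hom g(1) \<phi>\<psi>(2)[OF y]] hom_mult[OF hom \<phi>\<psi>(2)[OF y] g(1)] \<phi>\<psi>(1)[OF y] by simp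
      then have "\<phi> g \<in> N" using N(2) \<psi>\<phi>(2)[OF g(1)] by (auto simp: centralizer_def)
      then show "g \<in> \<psi> ` N" using \<psi>\<phi>(1)[OF g(1)] by (metis imageI)
    qed
    ultimately have "p \<in> \<psi> ` N"
      using p \<phi>\<psi>(2)[OF y] by (auto simp: pseudocentre_def normal_closure_def)
    then obtain q where "q \<in> N" "p = \<psi> q" by blast
    moreover have "N \<subseteq> carrier H" using N(1) normal_imp_subgroup subgroup.subset by blast
    ultimately show ?thesis using \<phi>\<psi>(1)[of q] by auto
  qed
  then show ?thesis by (auto simp: pseudocentre_def normal_closure_def)
qed

lemma iso_pseudocentre:
  assumes G: "group G" and H: "group H" and \<phi>: "\<phi> \<in> iso G H"
  shows "\<phi> ` pseudocentre G = pseudocentre H"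
proof
  show "\<phi> ` pseudocentre G \<subseteq> pseudocentre H" by (rule iso_pseudocentre_subset[OF assms])
  interpret G: group G by (rule G)
  let ?\<psi> = "inv_into (carrier G) \<phi>"
  have "?\<psi> ` pseudocentre H \<subseteq> pseudocentre G"
    by (rule iso_pseudocentre_subset[OF H G G.iso_set_sym[OF \<phi>]])
  \<comment> \<open>\<open>\<phi>\<close> undoes \<open>?\<psi>\<close> only on the carrier. The
    carrier is a normal subgroup containing the centralizer of the unit, so it bounds the
    intersection.\<close>
  moreover have "pseudocentre H \<subseteq> carrier H"
  proof -
    have "normal_closure H A \<subseteq> carrier H" if "A \<subseteq> carrier H" for A
      using that group.normal_self[OF H] by (auto simp: normal_closure_def)
    moreover have "centralizer H \<one>\<^bsub>H\<^esub> \<subseteq> carrier H" by (auto simp: centralizer_def)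
    moreover have "pseudocentre H \<subseteq> normal_closure H (centralizer H \<one>\<^bsub>H\<^esub>)"
      using monoid.one_closed[OF group.is_monoid[OF H]] by (auto simp: pseudocentre_def)
    ultimately show ?thesis by blast
  qed
  moreover have "\<phi> (?\<psi> y) = y" if "y \<in> carrier H" for y
    using that \<phi> bij_betw_inv_into_right by (fastforce simp: iso_def)
  ultimately show "pseudocentre H \<subseteq> \<phi> ` pseudocentre G" by (force simp: image_subset_iff image_iff)
qed

theorem theorem9p3:
  shows "pseudocentre thompson_F = derived thompson_F (carrier thompson_F)"
proof -
  let ?r = "\<lambda>f. restrict f {0..1::real}"
  interpret r: group_hom thompson_line_group thompson_F ?r
    using group_thompson_line_group group_thompson_F thompson_F_iso
    by (simp add: group_hom_def group_hom_axioms_def iso_def)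
  have "carrier thompson_F = ?r ` thompson_line"
    using thompson_F_iso by (auto simp: iso_def bij_betw_def)
  then have "derived thompson_F (carrier thompson_F) = ?r ` derived thompson_line_group thompson_line"
    using r.derived_img[of thompson_line] by simp
  also have "\<dots> = pseudocentre thompson_F"
    using iso_pseudocentre[OF group_thompson_line_group group_thompson_F thompson_F_iso]
    by (simp add: pseudocentre_thompson_line_group)
  finally show ?thesis by simp
qed

end
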